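(* Let $\gamma\in\{1,-1\}$, $\sigma\in(0,3/2]$, and let $a_n>0$, $b_n\in\mathbb R$ ($n\in\mathbb Z_+$) satisfy, as $n\to\infty$, $$a_n=n^\sigma(1+\alpha n^{-1}+O(n^{-2})),\qquad b_n=2\gamma n^\sigma(1+\beta n^{-1}+O(n^{-2})),$$ with $\alpha,\beta\in\mathbb R$; put $\tau=2\beta-2\alpha+\sigma$, and if $\sigma>1$ assume $\tau<0$. Let $\mathcal S=\mathbb R$ if $\sigma\in(1,3/2]$, $\mathcal S=\gamma(0,\infty)$ if $\sigma\in(0,1)$, and $\mathcal S=\gamma(\tau,\infty)$ if $\sigma=1$. Let $J$ be the corresponding self-adjoint Jacobi operator and $R(z)=(J-zI)^{-1}$. Then for all finitely supported $u,v\in\ell^2(\mathbb Z_+)$ the functions $\langle R(z)u,v\rangle$ are continuous in $z$ up to the cut along $\mathcal S$ as $z$ approaches $\mathcal S$ from the upper or lower half-plane.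
   Context: $\mathbb Z_+=\{0,1,2,\dots\}$; $\gamma(c,\infty)=\{\gamma x:x>c\}$. The minimal Jacobi operator $J_{\min}$ acts on finitely supported sequences by $(J_{\min}u)_0=b_0u_0+a_0u_1$, $(J_{\min}u)_n=a_{n-1}u_{n-1}+b_nu_n+a_nu_{n+1}$ for $n\ge1$. Under the hypotheses it is essentially self-adjoint, and $J$ is its closure. $\langle\cdot,\cdot\rangle$ is the scalar product in $\ell^2(\mathbb Z_+)$. "Continuous up to the cut along $\mathcal S$" means that the function, restricted to the open upper (respectively lower) half-plane, extends continuously to the union of this half-plane and $\mathcal S$; the two extensions may differ on $\mathcal S$. *)

theory Defs
  imports Complex_Main "HOL-Library.Landau_Symbols"
begin

definition l2 :: "(nat \<Rightarrow> complex) set" where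
  "l2 = {u. summable (\<lambda>n. (cmod (u n))\<^sup>2)}"

definition l2_norm :: "(nat \<Rightarrow> complex) \<Rightarrow> real" where
  "l2_norm u = sqrt (\<Sum>n. (cmod (u n))\<^sup>2)"

definition l2_inner :: "(nat \<Rightarrow> complex) \<Rightarrow> (nat \<Rightarrow> complex) \<Rightarrow> complex" where
  "l2_inner u v = (\<Sum>n. u n * cnj (v n))"

definition finitely_supported :: "(nat \<Rightarrow> complex) \<Rightarrow> bool" where
  "finitely_supported u \<longleftrightarrow> finite {n. u n \<noteq> 0}"

definition jacobi_expr :: "(nat \<Rightarrow> real) \<Rightarrow> (nat \<Rightarrow> real) \<Rightarrow> (nat \<Rightarrow> complex) \<Rightarrow> nat \<Rightarrow> complex" where
  "jacobi_expr a b u n =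
     (if n = 0 then of_real (b 0) * u 0 + of_real (a 0) * u 1
      else of_real (a (n - 1)) * u (n - 1) + of_real (b n) * u n + of_real (a n) * u (n + 1))"

text \<open>Unbounded operators in \<open>l2\<close> are represented by their graphs.\<close>

type_synonym l2_op = "((nat \<Rightarrow> complex) \<times> (nat \<Rightarrow> complex)) set"

definition jacobi_min :: "(nat \<Rightarrow> real) \<Rightarrow> (nat \<Rightarrow> real) \<Rightarrow> l2_op" where
  "jacobi_min a b = {(u, jacobi_expr a b u) | u. finitely_supported u}"

definition op_closure :: "l2_op \<Rightarrow> l2_op" where
  "op_closure T = {(u, w). u \<in> l2 \<and> w \<in> l2 \<and>
     (\<exists>us ws. (\<forall>k. (us k, ws k) \<in> T)
        \<and> (\<lambda>k. l2_norm (\<lambda>n. us k n - u n)) \<longlonglongrightarrow> 0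
        \<and> (\<lambda>k. l2_norm (\<lambda>n. ws k n - w n)) \<longlonglongrightarrow> 0)}"

text \<open>When the minimal operator is essentially self-adjoint, its closure is the
  self-adjoint Jacobi operator with the given coefficients.\<close>

definition jacobi_op :: "(nat \<Rightarrow> real) \<Rightarrow> (nat \<Rightarrow> real) \<Rightarrow> l2_op" where
  "jacobi_op a b = op_closure (jacobi_min a b)"

text \<open>\<open>resolvent T z u\<close> is the unique \<open>f\<close> in the domain of \<open>T\<close> with \<open>T f - z f = u\<close>; it is
  meaningful only if \<open>z\<close> lies in the resolvent set, in particular for nonreal \<open>z\<close> and
  self-adjoint \<open>T\<close>.\<close>

definition resolvent :: "l2_op \<Rightarrow> complex \<Rightarrow> (nat \<Rightarrow> complex) \<Rightarrow> (nat \<Rightarrow> complex)" where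
  "resolvent T z u = (THE f. \<exists>w. (f, w) \<in> T \<and> (\<forall>n. w n - z * f n = u n))"

text \<open>The two extensions are independent of each other and may differ on \<open>S\<close>; values of
  \<open>F\<close> on the real axis are irrelevant.\<close>

definition continuous_up_to_cut :: "(complex \<Rightarrow> complex) \<Rightarrow> real set \<Rightarrow> bool" where
  "continuous_up_to_cut F S \<longleftrightarrow>
     (\<exists>G. continuous_on ({z. Im z > 0} \<union> complex_of_real ` S) G \<and> (\<forall>z. Im z > 0 \<longrightarrow> G z = F z)) \<and>
     (\<exists>G. continuous_on ({z. Im z < 0} \<union> complex_of_real ` S) G \<and> (\<forall>z. Im z < 0 \<longrightarrow> G z = F z))"

definition cut_set :: "real \<Rightarrow> real \<Rightarrow> real \<Rightarrow> real set" where
  "cut_set \<gamma> \<sigma> \<tau> =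
     (if \<sigma> > 1 then UNIV
      else if \<sigma> < 1 then (\<lambda>x. \<gamma> * x) ` {0<..}
      else (\<lambda>x. \<gamma> * x) ` {\<tau><..})"

end

theory Submission
  imports Defs "HOL-Analysis.Analysis" "HOL-Real_Asymp.Real_Asymp"
begin

text \<open>The matrix elements of the resolvent are finite sums of values of the Green function, which is
built from the orthogonal polynomials \<open>P\<close> and from the Weyl function \<open>M z = \<langle>R(z) delta0, delta0\<rangle>\<close>
(\<open>resolvent_Green\<close>). As the polynomials are entire in \<open>z\<close>, everything reduces to two facts: \<open>P z\<close> is not in \<open>l2\<close> for
nonreal \<open>z\<close>, so that the closure of the minimal operator has the Green function as its resolvent, and \<open>M\<close>
extends continuously to the cut.

The Weyl function is an infinite composition of Moebius maps \<open>w \<mapsto> 1 / (b k - z - (a k)\<^sup>2 * w)\<close>.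
They map the upper half-plane to itself and do not increase hyperbolic distances as long as \<open>Im z \<ge> 0\<close>, real \<open>z\<close> included. A sequence
of points \<open>Z n z\<close> that follows the backward recursion up to hyperbolic errors summable locally
uniformly in \<open>z\<close> therefore yields \<open>M\<close> as a locally uniform limit of continuous functions, up to the
cut (\<open>weyl_limit_continuous\<close>). For \<open>Im z < 0\<close> the inverse maps preserve the upper half-plane. Run forwards, the same
almost-solution controls the quotients of consecutive polynomials and shows that
\<open>(cmod (P z n))\<^sup>2\<close> is at least a multiple of \<open>1 / s n\<close>, where \<open>s n = n powr \<rho>\<close> (\<open>P_not_l2\<close>). Here \<open>\<rho> \<le> 1\<close> is
the condition \<open>\<sigma> \<le> 3 / 2\<close>.

The points \<open>Z n z\<close> come from a WKB-like analysis (\<open>local_residual\<close>). After removing the sign \<open>(-1)\<^sup>n\<close> and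
rescaling the Riccati variable by \<open>s n\<close>, one step of the recursion fixes, up to summable terms, the root
\<open>X n z\<close> of an explicit quadratic polynomial. Its discriminant tends to \<open>-4 * Llim z\<close>, and \<open>Llim z\<close>
is positive on the cut and never a nonpositive real off the real axis; thus the root stays away from the
real line, and as it depends on \<open>n\<close> with bounded variation, the errors are summable.\<close>

section \<open>Square-summable sequences\<close>

lemma l2_norm_nonneg [simp]: "u \<in> l2 \<Longrightarrow> 0 \<le> l2_norm u"
  by (auto simp: l2_norm_def l2_def intro!: suminf_nonneg)

lemma L2_set_le_l2_norm:
  assumes "u \<in> l2" "finite F"
  shows "L2_set (\<lambda>n. cmod (u n)) F \<le> l2_norm u"
  using assms unfolding L2_set_def l2_norm_def l2_def
  by (auto intro!: sum_le_suminf)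

lemma l2_boundedI:
  assumes "\<And>N. L2_set (\<lambda>n. cmod (u n)) {..<N} \<le> K"
  shows "u \<in> l2" "l2_norm u \<le> K"
proof -
  have K: "0 \<le> K" using assms[of 0] by simp
  have le: "(\<Sum>n<N. (cmod (u n))\<^sup>2) \<le> K\<^sup>2" for N
    using assms[of N] K unfolding L2_set_def by (simp add: real_sqrt_le_iff' sum_nonneg)
  have s: "summable (\<lambda>n. (cmod (u n))\<^sup>2)"
    by (rule summableI_nonneg_bounded[OF _ le]) simp
  then show "u \<in> l2" by (simp add: l2_def)
  have "(\<Sum>n. (cmod (u n))\<^sup>2) \<le> K\<^sup>2" using suminf_le_const[OF s] le by blast
  then show "l2_norm u \<le> K" using K unfolding l2_norm_def
    by (metis real_sqrt_le_mono real_sqrt_abs abs_of_nonneg)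
qed

lemma l2_add:
  assumes "u \<in> l2" "v \<in> l2"
  shows "(\<lambda>n. u n + v n) \<in> l2" "l2_norm (\<lambda>n. u n + v n) \<le> l2_norm u + l2_norm v"
proof -
  have "L2_set (\<lambda>n. cmod (u n + v n)) {..<N} \<le> l2_norm u + l2_norm v" for N
  proof -
    have "L2_set (\<lambda>n. cmod (u n + v n)) {..<N} \<le> L2_set (\<lambda>n. cmod (u n) + cmod (v n)) {..<N}"
      by (intro L2_set_mono) (auto intro: norm_triangle_ineq)
    also have "\<dots> \<le> L2_set (\<lambda>n. cmod (u n)) {..<N} + L2_set (\<lambda>n. cmod (v n)) {..<N}"
      by (rule L2_set_triangle_ineq)
    also have "\<dots> \<le> l2_norm u + l2_norm v"
      by (intro add_mono L2_set_le_l2_norm assms) auto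
    finally show ?thesis .
  qed
  then show "(\<lambda>n. u n + v n) \<in> l2" "l2_norm (\<lambda>n. u n + v n) \<le> l2_norm u + l2_norm v"
    by (rule l2_boundedI)+
qed

lemma l2_scale:
  assumes "u \<in> l2"
  shows "(\<lambda>n. c * u n) \<in> l2" "l2_norm (\<lambda>n. c * u n) = cmod c * l2_norm u"
  using assms
  by (auto simp: l2_def l2_norm_def norm_mult power_mult_distrib suminf_mult real_sqrt_mult
      intro: summable_mult)

lemma l2_diff:
  assumes "u \<in> l2" "v \<in> l2"
  shows "(\<lambda>n. u n - v n) \<in> l2" "l2_norm (\<lambda>n. u n - v n) \<le> l2_norm u + l2_norm v"
  using l2_add[OF assms(1) l2_scale(1)[OF assms(2), of "-1"]] l2_scale(2)[OF assms(2), of "-1"]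
  by simp_all

lemma finitely_supported_l2: "finitely_supported u \<Longrightarrow> u \<in> l2"
  unfolding finitely_supported_def l2_def mem_Collect_eq
  by (rule summable_finite) auto

lemma cmod_le_l2_norm: "u \<in> l2 \<Longrightarrow> cmod (u n) \<le> l2_norm u"
  using L2_set_le_l2_norm[of u "{n}"] by simp

lemma finitely_supported_bound:
  assumes "finitely_supported u" obtains N where "\<And>n. n \<ge> N \<Longrightarrow> u n = 0"
proof -
  obtain N where N: "\<forall>n\<in>{n. u n \<noteq> 0}. n \<le> N"
    using assms unfolding finitely_supported_def finite_nat_set_iff_bounded_le by blast
  have "u n = 0" if "n \<ge> Suc N" for n
  proof (rule ccontr)
    assume "u n \<noteq> 0"
    with N have "n \<le> N" by blast
    with that show False by simp
  qed
  then show ?thesis by (rule that)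
qed

lemma finitely_supportedI: "(\<And>n. n \<ge> N \<Longrightarrow> u n = 0) \<Longrightarrow> finitely_supported u"
  unfolding finitely_supported_def
  by (rule finite_subset[of _ "{..<N}"]) (auto intro: leI)

lemma finitely_supported_diff:
  assumes "finitely_supported u" "finitely_supported v"
  shows "finitely_supported (\<lambda>n. u n - v n)"
  unfolding finitely_supported_def
  by (rule finite_subset[of _ "{n. u n \<noteq> 0} \<union> {n. v n \<noteq> 0}"]) (use assms in \<open>auto simp: finitely_supported_def\<close>)

text \<open>A Cauchy sequence in \<open>l2\<close> converges pointwise, and the bounds on finite sections of its
differences survive the passage to the pointwise limit. The modulus is given as a sum
\<open>e j + e k\<close> because that is how it arises from the a priori bound for approximate solutions.\<close>

lemma l2_complete:
  assumes l2: "\<And>k. us k \<in> l2" and e: "e \<longlonglongrightarrow> (0::real)"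
    and cau: "\<And>j k. l2_norm (\<lambda>n. us j n - us k n) \<le> e j + e k"
  obtains g where "g \<in> l2" "(\<lambda>k. l2_norm (\<lambda>n. us k n - g n)) \<longlonglongrightarrow> 0"
proof -
  have pt: "cmod (us j n - us k n) \<le> e j + e k" for j k n
    using cmod_le_l2_norm[OF l2_diff(1)[OF l2 l2]] cau order_trans by blast
  have "Cauchy (\<lambda>k. us k n)" for n
  proof (rule CauchyI)
    fix r :: real assume "r > 0"
    then obtain N where N: "\<And>k. k \<ge> N \<Longrightarrow> norm (e k) < r / 2"
      using LIMSEQ_D[OF e, of "r/2"] by auto
    show "\<exists>M. \<forall>m\<ge>M. \<forall>k\<ge>M. norm (us m n - us k n) < r"
    proof (intro exI allI impI)
      fix m k assume "m \<ge> N" "k \<ge> N"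
      then show "norm (us m n - us k n) < r" using pt[of m n k] N[of m] N[of k] by simp
    qed
  qed
  then have "\<forall>n. \<exists>x. (\<lambda>k. us k n) \<longlonglongrightarrow> x"
    by (simp add: Cauchy_convergent_iff convergent_def)
  then obtain g where g: "\<And>n. (\<lambda>k. us k n) \<longlonglongrightarrow> g n" by metis
  have b: "L2_set (\<lambda>n. cmod (us k n - g n)) {..<N} \<le> e k" for k N
  proof (rule LIMSEQ_le)
    show "(\<lambda>j. L2_set (\<lambda>n. cmod (us k n - us j n)) {..<N}) \<longlonglongrightarrow> L2_set (\<lambda>n. cmod (us k n - g n)) {..<N}"
      unfolding L2_set_def by (intro tendsto_intros g)
    show "(\<lambda>j. e k + e j) \<longlonglongrightarrow> e k" using tendsto_add[OF tendsto_const e, of "e k"] by simp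
    show "\<exists>M. \<forall>j\<ge>M. L2_set (\<lambda>n. cmod (us k n - us j n)) {..<N} \<le> e k + e j"
      using L2_set_le_l2_norm[OF l2_diff(1)[OF l2 l2]] cau order_trans by blast
  qed
  have d: "(\<lambda>n. us k n - g n) \<in> l2" for k by (rule l2_boundedI(1)[OF b])
  have "g \<in> l2" using l2_diff(1)[OF l2[of 0] d[of 0]] by simp
  moreover have "(\<lambda>k. l2_norm (\<lambda>n. us k n - g n)) \<longlonglongrightarrow> 0"
    by (rule tendsto_sandwich[OF _ _ tendsto_const e])
      (auto intro!: always_eventually l2_norm_nonneg d l2_boundedI(2)[OF b])
  ultimately show ?thesis by (rule that)
qed

section \<open>The Jacobi difference equation\<close>

text \<open>Row \<open>n\<close> of \<open>(J - z) f = h\<close> determines \<open>f (n + 1)\<close> from its predecessors, and row \<open>0\<close> already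
determines \<open>f 1\<close> from \<open>f 0\<close>. The solutions therefore form a one-parameter family, indexed by the
initial value \<open>c\<close>.\<close>

fun sol :: "(nat \<Rightarrow> real) \<Rightarrow> (nat \<Rightarrow> real) \<Rightarrow> complex \<Rightarrow> (nat \<Rightarrow> complex) \<Rightarrow> complex \<Rightarrow> nat \<Rightarrow> complex" where
  "sol a b z h c 0 = c"
| "sol a b z h c (Suc 0) = (h 0 - (of_real (b 0) - z) * c) / of_real (a 0)"
| "sol a b z h c (Suc (Suc n)) =
     (h (Suc n) - (of_real (b (Suc n)) - z) * sol a b z h c (Suc n) - of_real (a n) * sol a b z h c n)
       / of_real (a (Suc n))"

definition jac_diff :: "(nat \<Rightarrow> real) \<Rightarrow> (nat \<Rightarrow> real) \<Rightarrow> complex \<Rightarrow> (nat \<Rightarrow> complex) \<Rightarrow> nat \<Rightarrow> complex" where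
  "jac_diff a b z f n = jacobi_expr a b f n - z * f n"

abbreviation delta0 :: "nat \<Rightarrow> complex" where "delta0 \<equiv> (\<lambda>n. if n = 0 then 1 else 0)"

lemma jac_diff_0: "jac_diff a b z f 0 = (of_real (b 0) - z) * f 0 + of_real (a 0) * f (Suc 0)"
  by (simp add: jac_diff_def jacobi_expr_def algebra_simps)

lemma jac_diff_Suc:
  "jac_diff a b z f (Suc n) =
     of_real (a n) * f n + (of_real (b (Suc n)) - z) * f (Suc n) + of_real (a (Suc n)) * f (Suc (Suc n))"
  by (simp add: jac_diff_def jacobi_expr_def algebra_simps)

lemma jac_diff_linear:
  "jac_diff a b z (\<lambda>n. f n + c * g n) n = jac_diff a b z f n + c * jac_diff a b z g n"
  by (cases n) (simp_all add: jac_diff_0 jac_diff_Suc algebra_simps)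

lemma jac_diff_diff:
  "jac_diff a b z (\<lambda>n. f n - g n) n = jac_diff a b z f n - jac_diff a b z g n"
  using jac_diff_linear[of a b z f "-1" g n] by simp

lemma jac_diff_sum:
  "jac_diff a b z (\<lambda>n. \<Sum>k\<in>A. g k n) n = (\<Sum>k\<in>A. jac_diff a b z (g k) n)"
  by (cases n) (simp_all add: jac_diff_0 jac_diff_Suc sum_distrib_left sum.distrib)

lemma green_identity:
  "(\<Sum>k\<le>n. jac_diff a b z f k * g k - f k * jac_diff a b z g k)
     = of_real (a n) * (f (Suc n) * g n - f n * g (Suc n))"
  by (induction n) (simp_all add: jac_diff_0 jac_diff_Suc algebra_simps)

text \<open>The imaginary part of \<open>cnj f * (J - z) f\<close> telescopes, because the coefficients are real.
Applied to finitely supported \<open>f\<close>, to the polynomials \<open>P\<close> and to solutions with a controlled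
ratio \<open>f (n + 1) / f n\<close>, this one identity gives the a priori bound for the resolvent, the absence of zeros of
\<open>P\<close> off the real axis, and the square summability of the Weyl solution.\<close>

lemma energy_identity:
  "(\<Sum>k\<le>n. Im (cnj (f k) * jac_diff a b z f k))
     = a n * Im (cnj (f n) * f (Suc n)) - Im z * (\<Sum>k\<le>n. (cmod (f k))\<^sup>2)"
proof (induction n)
  case 0
  show ?case unfolding cmod_power2 by (simp add: jac_diff_0 algebra_simps power2_eq_square)
next
  case (Suc n)
  show ?case
    unfolding sum.atMost_Suc Suc
    unfolding cmod_power2 by (simp add: jac_diff_Suc algebra_simps power2_eq_square)
qed

lemma sol_cnj:
  assumes "\<And>n. cnj (h n) = h n"
  shows "sol a b (cnj z) h (cnj c) n = cnj (sol a b z h c n)"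
proof -
  have "sol a b (cnj z) h (cnj c) n = cnj (sol a b z h c n) \<and>
      sol a b (cnj z) h (cnj c) (Suc n) = cnj (sol a b z h c (Suc n))"
    by (induction n) (simp_all add: assms)
  then show ?thesis by simp
qed

locale jacobi =
  fixes a b :: "nat \<Rightarrow> real"
  assumes a_pos: "\<And>n. a n > 0"
begin

text \<open>The orthogonal polynomials of the Jacobi matrix, as functions of \<open>n\<close> for fixed \<open>z\<close>.\<close>

abbreviation P :: "complex \<Rightarrow> nat \<Rightarrow> complex" where
  "P z \<equiv> sol a b z (\<lambda>_. 0) 1"

lemma a_nz [simp]: "a n \<noteq> 0" using a_pos[of n] by simp

lemma jac_diff_sol [simp]: "jac_diff a b z (sol a b z h c) n = h n"
  by (cases n) (simp_all add: jac_diff_0 jac_diff_Suc)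

lemma continuous_on_sol:
  assumes "continuous_on A M"
  shows "continuous_on A (\<lambda>z. sol a b z h (M z) n)"
proof (induction n rule: less_induct)
  case (less n)
  consider "n = 0" | "n = Suc 0" | m where "n = Suc (Suc m)"
    by (metis not0_implies_Suc)
  then show ?case
    by cases (auto intro!: continuous_intros assms less)
qed

lemma sol_unique:
  assumes "\<And>n. jac_diff a b z f n = h n"
  shows "f n = sol a b z h (f 0) n"
proof (induction n rule: less_induct)
  case (less n)
  consider "n = 0" | "n = Suc 0" | m where "n = Suc (Suc m)"
    by (metis not0_implies_Suc)
  then show ?case
  proof cases
    case 2
    show ?thesis using assms[of 0] by (simp add: 2 jac_diff_0 field_simps)
  next
    case (3 m)
    have "sol a b z h (f 0) m = f m" "sol a b z h (f 0) (Suc m) = f (Suc m)"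
      using less[of m] less[of "Suc m"] 3 by simp_all
    then show ?thesis using assms[of "Suc m"] by (simp add: 3 jac_diff_Suc field_simps)
  qed simp
qed

lemma sol_shift: "sol a b z h c n = sol a b z h 0 n + c * P z n"
proof -
  let ?f = "\<lambda>n. sol a b z h 0 n + c * P z n"
  have "?f n = sol a b z h (?f 0) n"
    by (rule sol_unique) (simp add: jac_diff_linear)
  then show ?thesis by simp
qed

lemma homogeneous_unique:
  assumes "\<And>n. jac_diff a b z f n = 0"
  shows "f n = f 0 * P z n"
proof -
  have "(\<lambda>n. f 0 * P z n) n = sol a b z (\<lambda>_. 0) (f 0 * P z 0) n"
    by (rule sol_unique) (use jac_diff_linear[of a b z "\<lambda>_. 0" "f 0" "P z"] in
      \<open>simp add: jac_diff_def[of a b z "\<lambda>_. 0"] jacobi_expr_def[of a b "\<lambda>_. 0"]\<close>)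
  with sol_unique[OF assms, of n] show ?thesis by simp
qed

lemma energy_P: "a n * Im (cnj (P z n) * P z (Suc n)) = Im z * (\<Sum>k\<le>n. (cmod (P z k))\<^sup>2)"
  using energy_identity[where f="P z" and z=z and a=a and b=b and n=n] by simp

lemma sum_P_ge_1: "(\<Sum>k\<le>n. (cmod (P z k))\<^sup>2) \<ge> 1"
proof -
  have "(cmod (P z 0))\<^sup>2 \<le> (\<Sum>k\<le>n. (cmod (P z k))\<^sup>2)"
    by (rule member_le_sum) auto
  then show ?thesis by simp
qed

lemma P_nonzero: "Im z \<noteq> 0 \<Longrightarrow> P z n \<noteq> 0"
  using energy_P[where n=n and z=z] sum_P_ge_1[where n=n and z=z] by auto

lemma jac_diff_finite:
  "finitely_supported f \<Longrightarrow> finitely_supported (jac_diff a b z f)"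
proof -
  assume "finitely_supported f"
  then obtain N where N: "\<And>n. n \<ge> N \<Longrightarrow> f n = 0" using finitely_supported_bound by blast
  show ?thesis
  proof (rule finitely_supportedI[of "Suc N"])
    fix n assume "n \<ge> Suc N"
    then obtain m where "n = Suc m" "m \<ge> N" by (metis Suc_le_D Suc_le_mono)
    then show "jac_diff a b z f n = 0" using N by (simp add: jac_diff_Suc)
  qed
qed

lemma apriori_bound:
  assumes "finitely_supported f"
  shows "\<bar>Im z\<bar> * l2_norm f \<le> l2_norm (jac_diff a b z f)"
proof -
  let ?h = "jac_diff a b z f"
  have h: "?h \<in> l2" and f: "f \<in> l2"
    using assms by (auto intro: finitely_supported_l2 jac_diff_finite)
  obtain N where N: "\<And>n. n \<ge> N \<Longrightarrow> f n = 0" using assms finitely_supported_bound by blast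
  have sum: "l2_norm f = L2_set (\<lambda>n. cmod (f n)) {..N}"
    unfolding l2_norm_def L2_set_def
    by (subst suminf_finite[of "{..N}"]) (auto simp: N)
  define F where "F = L2_set (\<lambda>n. cmod (f n)) {..N}"
  have F0: "F \<ge> 0" by (simp add: F_def)
  have F2: "F\<^sup>2 = (\<Sum>k\<le>N. (cmod (f k))\<^sup>2)"
    unfolding F_def L2_set_def by (simp add: sum_nonneg)
  have "(\<Sum>k\<le>N. Im (cnj (f k) * ?h k)) = - Im z * F\<^sup>2"
    unfolding F2 using energy_identity[where f=f and z=z and a=a and b=b and n=N] by (simp add: N)
  then have "\<bar>Im z\<bar> * F\<^sup>2 = \<bar>\<Sum>k\<le>N. Im (cnj (f k) * ?h k)\<bar>"
    by (simp add: abs_mult)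
  also have "\<dots> \<le> (\<Sum>k\<le>N. \<bar>cmod (f k)\<bar> * \<bar>cmod (?h k)\<bar>)"
    by (rule order_trans[OF sum_abs], rule sum_mono)
      (metis abs_Im_le_cmod abs_norm_cancel complex_mod_cnj norm_mult)
  also have "\<dots> \<le> F * L2_set (\<lambda>n. cmod (?h n)) {..N}"
    unfolding F_def by (rule L2_set_mult_ineq)
  also have "\<dots> \<le> F * l2_norm ?h"
    by (intro mult_left_mono L2_set_le_l2_norm h F0) auto
  finally have "F * (\<bar>Im z\<bar> * F) \<le> F * l2_norm ?h" by (simp add: power2_eq_square mult_ac)
  then show ?thesis using F0 l2_norm_nonneg[OF h] unfolding sum F_def[symmetric]
    by (cases "F = 0") auto
qed

text \<open>Orthogonality to \<open>P\<close> is the only obstruction to solving \<open>(J - z) f = h\<close> by a finitely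
supported \<open>f\<close>: the initial value can be chosen such that \<open>f N = 0\<close>, Green's identity then forces
\<open>f (N + 1) = 0\<close>, and from there on the recursion only produces zeros.\<close>

lemma finite_preimage:
  assumes "Im z \<noteq> 0" and h: "\<And>n. n > N \<Longrightarrow> h n = 0" and orth: "(\<Sum>n\<le>N. h n * P z n) = 0"
  obtains f where "finitely_supported f" "\<And>n. jac_diff a b z f n = h n"
proof -
  define c where "c = - sol a b z h 0 N / P z N"
  define f where "f = sol a b z h c"
  have PN: "P z N \<noteq> 0" using P_nonzero assms(1) by blast
  have f0: "f N = 0" unfolding f_def by (subst sol_shift) (simp add: c_def PN)
  have "f (Suc N) * P z N - f N * P z (Suc N) = 0"
    using green_identity[where a=a and b=b and z=z and f=f and g="P z" and n=N] orth by (simp add: f_def)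
  with f0 PN have f1: "f (Suc N) = 0" by simp
  have "f (N + k) = 0 \<and> f (Suc (N + k)) = 0" for k
  proof (induction k)
    case (Suc k)
    have "jac_diff a b z f (Suc (N + k)) = 0" by (simp add: f_def h)
    with Suc show ?case by (simp add: jac_diff_Suc)
  qed (simp add: f0 f1)
  then have "finitely_supported f"
    by (intro finitely_supportedI[of N]) (metis le_iff_add)
  then show ?thesis using that[of f] by (simp add: f_def)
qed

text \<open>Essential self-adjointness in the limit point case, in a constructive form. The section of
\<open>cnj P\<close> to \<open>{..N}\<close> spans the orthogonal complement of the reachable right-hand sides; removing
from \<open>u\<close> its component along this vector costs \<open>cmod c / sqrt (S N)\<close> in norm, with
\<open>c\<close> independent of \<open>N\<close>, and this tends to \<open>0\<close> exactly when \<open>P\<close> is not in \<open>l2\<close>.\<close>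

lemma dense_range:
  assumes z: "Im z \<noteq> 0" and P: "P z \<notin> l2" and u: "finitely_supported u"
  obtains us where "\<And>k. finitely_supported (us k)"
    "(\<lambda>k. l2_norm (\<lambda>n. jac_diff a b z (us k) n - u n)) \<longlonglongrightarrow> 0"
proof -
  obtain N0 where N0: "\<And>n. n \<ge> N0 \<Longrightarrow> u n = 0" using u finitely_supported_bound by blast
  define S where "S N = (\<Sum>k\<le>N. (cmod (P z k))\<^sup>2)" for N
  have S1: "S N \<ge> 1" for N unfolding S_def by (rule sum_P_ge_1)
  define c where "c = (\<Sum>n<N0. u n * P z n)"
  have c: "(\<Sum>n\<le>k + N0. u n * P z n) = c" for k
    unfolding c_def by (rule sum.mono_neutral_right) (auto simp: N0)
  \<comment> \<open>the component of \<open>u\<close> along the section of \<open>cnj P\<close>; \<open>N0\<close> is added so that the support of \<open>u\<close> is always covered\<close>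
  define d where "d k n = (if n \<le> k + N0 then c / of_real (S (k + N0)) * cnj (P z n) else 0)" for k n
  have "\<exists>f. finitely_supported f \<and> (\<forall>n. jac_diff a b z f n = u n - d k n)" for k
  proof -
    have "(\<Sum>n\<le>k + N0. d k n * P z n) = (\<Sum>n\<le>k + N0. c / of_real (S (k + N0)) * of_real ((cmod (P z n))\<^sup>2))"
    proof (rule sum.cong[OF refl])
      have pp: "x * cnj p * p = x * of_real ((cmod p)\<^sup>2)" for x p
        unfolding complex_norm_square by (simp add: mult_ac)
      fix n assume "n \<in> {..k + N0}"
      then show "d k n * P z n = c / of_real (S (k + N0)) * of_real ((cmod (P z n))\<^sup>2)"
        unfolding d_def by (simp only: atMost_iff if_True pp)
    qed
    also have "\<dots> = c / of_real (S (k + N0)) * of_real (S (k + N0))"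
      unfolding sum_distrib_left[symmetric] S_def by simp
    also have "\<dots> = c" using S1[of "k + N0"] by simp
    finally have "(\<Sum>n\<le>k + N0. d k n * P z n) = c" .
    then have orth: "(\<Sum>n\<le>k + N0. (u n - d k n) * P z n) = 0"
      unfolding left_diff_distrib sum_subtractf c by simp
    have "u n - d k n = 0" if "n > k + N0" for n using that N0[of n] by (simp add: d_def)
    from finite_preimage[OF z this orth] show ?thesis by blast
  qed
  then obtain us where us: "\<And>k. finitely_supported (us k)" "\<And>k n. jac_diff a b z (us k) n = u n - d k n"
    by metis
  have "l2_norm (\<lambda>n. jac_diff a b z (us k) n - u n) = cmod c / sqrt (S (k + N0))" for k
  proof -
    have Spos: "S (k + N0) > 0" using S1[of "k + N0"] by linarith
    have "(\<Sum>n. (cmod (jac_diff a b z (us k) n - u n))\<^sup>2) = (\<Sum>n\<le>k + N0. (cmod (d k n))\<^sup>2)"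
      by (subst suminf_finite[of "{..k + N0}"]) (auto simp: us(2) d_def)
    also have "\<dots> = (\<Sum>n\<le>k + N0. (cmod c / S (k + N0))\<^sup>2 * (cmod (P z n))\<^sup>2)"
      by (rule sum.cong) (use Spos in \<open>auto simp: d_def norm_mult norm_divide power_mult_distrib power_divide\<close>)
    also have "\<dots> = (cmod c / S (k + N0))\<^sup>2 * S (k + N0)"
      by (simp add: S_def sum_distrib_left)
    also have "\<dots> = (cmod c)\<^sup>2 / S (k + N0)"
      using Spos by (simp add: power_divide power2_eq_square)
    finally show ?thesis by (simp add: l2_norm_def real_sqrt_divide)
  qed
  moreover have "(\<lambda>k. cmod c / sqrt (S (k + N0))) \<longlonglongrightarrow> 0"
  proof -
    have unb: "\<exists>n. K < S n" for K
    proof (rule ccontr)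
      assume "\<not> (\<exists>n. K < S n)"
      then have K: "\<And>n. S n \<le> K" by (simp add: not_less)
      have "(\<Sum>k<n. (cmod (P z k))\<^sup>2) \<le> K" for n
      proof -
        have "(\<Sum>k<n. (cmod (P z k))\<^sup>2) \<le> S n"
          unfolding S_def by (rule sum_mono2) auto
        with K[of n] show ?thesis by linarith
      qed
      then have "summable (\<lambda>k. (cmod (P z k))\<^sup>2)" by (intro summableI_nonneg_bounded) auto
      with P show False by (simp add: l2_def)
    qed
    have mono: "mono S" unfolding S_def by (intro monoI sum_mono2) auto
    have "filterlim S at_top sequentially"
      unfolding filterlim_at_top_dense eventually_sequentially
      using unb mono by (meson less_le_trans monoD)
    then have "filterlim (\<lambda>k. sqrt (S (k + N0))) at_top sequentially"
      by (intro filterlim_compose[OF sqrt_at_top] filterlim_compose[OF _ filterlim_add_const_nat_at_top])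
    then show ?thesis by (intro real_tendsto_divide_at_top[OF tendsto_const])
  qed
  ultimately show ?thesis using us(1) by (intro that[of us]) auto
qed

text \<open>The a priori bound holds on the minimal operator and is inherited by its closure through the
approximating sequences, so \<open>J - z\<close> is injective there.\<close>

lemma closure_unique:
  assumes z: "Im z \<noteq> 0"
    and 1: "(f, w) \<in> jacobi_op a b" "\<And>n. w n - z * f n = u n"
    and 2: "(f', w') \<in> jacobi_op a b" "\<And>n. w' n - z * f' n = u n"
  shows "f = f'"
proof
  fix n
  obtain us ws where us: "f \<in> l2" "w \<in> l2" "\<And>k. (us k, ws k) \<in> jacobi_min a b"
     "(\<lambda>k. l2_norm (\<lambda>n. us k n - f n)) \<longlonglongrightarrow> 0" "(\<lambda>k. l2_norm (\<lambda>n. ws k n - w n)) \<longlonglongrightarrow> 0"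
    using 1(1) unfolding jacobi_op_def op_closure_def by blast
  obtain us' ws' where us': "f' \<in> l2" "w' \<in> l2" "\<And>k. (us' k, ws' k) \<in> jacobi_min a b"
     "(\<lambda>k. l2_norm (\<lambda>n. us' k n - f' n)) \<longlonglongrightarrow> 0" "(\<lambda>k. l2_norm (\<lambda>n. ws' k n - w' n)) \<longlonglongrightarrow> 0"
    using 2(1) unfolding jacobi_op_def op_closure_def by blast
  have fin: "finitely_supported (us k)" "finitely_supported (us' k)" 
     and ws: "ws k = jacobi_expr a b (us k)" "ws' k = jacobi_expr a b (us' k)" for k
    using us(3)[of k] us'(3)[of k] by (auto simp: jacobi_min_def)
  have wfin: "ws k \<in> l2" "ws' k \<in> l2" for k
    using jac_diff_finite[OF fin(1)[of k], of 0] jac_diff_finite[OF fin(2)[of k], of 0]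
    by (auto simp: ws jac_diff_def[abs_def] intro: finitely_supported_l2)
  let ?A = "\<lambda>k. l2_norm (\<lambda>n. us k n - f n)" and ?B = "\<lambda>k. l2_norm (\<lambda>n. ws k n - w n)"
  let ?A' = "\<lambda>k. l2_norm (\<lambda>n. us' k n - f' n)" and ?B' = "\<lambda>k. l2_norm (\<lambda>n. ws' k n - w' n)"
  have l2: "(\<lambda>n. us k n - f n) \<in> l2" "(\<lambda>n. ws k n - w n) \<in> l2"
    "(\<lambda>n. us' k n - f' n) \<in> l2" "(\<lambda>n. ws' k n - w' n) \<in> l2" for k
    using us(1,2) us'(1,2) wfin finitely_supported_l2[OF fin(1)] finitely_supported_l2[OF fin(2)]
    by (simp_all add: l2_diff)
  let ?E = "\<lambda>k. (?B k + cmod z * ?A k + (?B' k + cmod z * ?A' k)) / \<bar>Im z\<bar> + (?A k + ?A' k)"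
  have bound: "cmod (f n - f' n) \<le> ?E k" for k
  proof -
    let ?d = "\<lambda>n. us k n - us' k n"
    let ?x = "\<lambda>n. (ws k n - w n) + (- z) * (us k n - f n)"
    let ?x' = "\<lambda>n. (ws' k n - w' n) + (- z) * (us' k n - f' n)"
    have "jac_diff a b z ?d = (\<lambda>n. ?x n - ?x' n)"
    proof
      fix n show "jac_diff a b z ?d n = ?x n - ?x' n"
        using 1(2)[of n] 2(2)[of n] unfolding jac_diff_diff
        by (simp add: jac_diff_def ws algebra_simps)
    qed
    then have "\<bar>Im z\<bar> * l2_norm ?d \<le> l2_norm (\<lambda>n. ?x n - ?x' n)"
      using apriori_bound[OF finitely_supported_diff[OF fin], of z k k] by simp
    also have "\<dots> \<le> l2_norm ?x + l2_norm ?x'"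
      by (intro l2_diff l2_add l2_scale l2)
    also have "\<dots> \<le> (?B k + cmod z * ?A k) + (?B' k + cmod z * ?A' k)"
      using l2_add(2)[OF l2(2) l2_scale(1)[OF l2(1)], of k "-z" k]
        l2_add(2)[OF l2(4) l2_scale(1)[OF l2(3)], of k "-z" k]
        l2_scale(2)[OF l2(1), of "-z" k] l2_scale(2)[OF l2(3), of "-z" k] by simp
    finally have d: "l2_norm ?d \<le> ((?B k + cmod z * ?A k) + (?B' k + cmod z * ?A' k)) / \<bar>Im z\<bar>"
      using z by (simp add: field_simps)
    have "cmod (f n - f' n) = cmod (?d n - (us k n - f n) + (us' k n - f' n))" by simp
    also have "\<dots> \<le> cmod (?d n) + cmod (us k n - f n) + cmod (us' k n - f' n)"
      using norm_triangle_ineq[of "?d n - (us k n - f n)" "us' k n - f' n"]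
        norm_triangle_ineq4[of "?d n" "us k n - f n"] by linarith
    also have "\<dots> \<le> l2_norm ?d + ?A k + ?A' k"
      by (intro add_mono cmod_le_l2_norm l2 finitely_supported_l2[OF finitely_supported_diff[OF fin]]
           cmod_le_l2_norm[of ?d] cmod_le_l2_norm[OF l2(1)] cmod_le_l2_norm[OF l2(3)])
    finally show ?thesis using d by linarith
  qed
  have "?E \<longlonglongrightarrow> (0 + cmod z * 0 + (0 + cmod z * 0)) / \<bar>Im z\<bar> + (0 + 0)"
    using z by (intro tendsto_intros us us') auto
  then have "cmod (f n - f' n) \<le> 0"
    using bound by (intro LIMSEQ_le_const[where X="?E"]) auto
  then show "f n = f' n" by simp
qed

text \<open>If \<open>M\<close> is the value at \<open>0\<close> of the square-summable solution of \<open>(J - z) f = delta0\<close>, this is the kernel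
of the resolvent. All of its dependence on the behaviour at infinity sits in the number \<open>M\<close>.\<close>

definition Green :: "complex \<Rightarrow> complex \<Rightarrow> nat \<Rightarrow> nat \<Rightarrow> complex" where
  "Green z M k n = P z (min n k) * sol a b z delta0 M (max n k)"

lemma jac_diff_Green: "jac_diff a b z (Green z M k) n = (if n = k then 1 else 0)"
proof -
  let ?f = "sol a b z delta0 M"
  \<comment> \<open>the Wronskian of \<open>f\<close> and \<open>P\<close>, which produces the diagonal jump\<close>
  have W: "of_real (a n) * (?f (Suc n) * P z n - ?f n * P z (Suc n)) = 1" for n
    
  proof -
    have "(\<Sum>k\<le>n. jac_diff a b z ?f k * P z k - ?f k * jac_diff a b z (P z) k) = (\<Sum>k\<le>n. if k = 0 then 1 else 0)"
      by (rule sum.cong) auto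
    then show ?thesis using green_identity[where a=a and b=b and z=z and f="?f" and g="P z" and n=n]
      by (simp del: sol.simps)
  qed
  have fS: "of_real (a m) * ?f m + (of_real (b (Suc m)) - z) * ?f (Suc m)
      + of_real (a (Suc m)) * ?f (Suc (Suc m)) = 0" for m
    using jac_diff_sol[of z delta0 M "Suc m"] unfolding jac_diff_Suc by simp
  have PS: "of_real (a m) * P z m + (of_real (b (Suc m)) - z) * P z (Suc m)
      + of_real (a (Suc m)) * P z (Suc (Suc m)) = 0" for m
    using jac_diff_sol[of z "\<lambda>_. 0" 1 "Suc m"] unfolding jac_diff_Suc by simp
  show ?thesis
  proof (cases "n < k")
    case True
    have "jac_diff a b z (Green z M k) n = jac_diff a b z (P z) n * ?f k"
      using True by (cases n)
        (simp_all add: jac_diff_0 jac_diff_Suc Green_def min_def max_def algebra_simps del: sol.simps)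
    then show ?thesis using True by simp
  next
    case False
    then consider "n = k" | "n > k" by linarith
    then show ?thesis
    proof cases
      case 2
      then obtain m where m: "n = Suc m" "m \<ge> k" by (metis Suc_le_mono Suc_leI Suc_le_D)
      have "jac_diff a b z (Green z M k) n = P z k * jac_diff a b z ?f n"
        using m by (simp add: jac_diff_Suc Green_def min_def max_def algebra_simps del: sol.simps)
      then show ?thesis using 2 by simp
    next
      case 1
      show ?thesis
      proof (cases k)
        case 0
        have "jac_diff a b z (Green z M k) n = P z 0 * jac_diff a b z ?f 0"
          using 1 0 by (simp add: jac_diff_0 Green_def min_def max_def)
        then show ?thesis using 1 0 by simp
      next
        case (Suc m)
        have "jac_diff a b z (Green z M k) n
            = of_real (a m) * P z m * ?f (Suc m) + (of_real (b (Suc m)) - z) * P z (Suc m) * ?f (Suc m)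
             + of_real (a (Suc m)) * P z (Suc m) * ?f (Suc (Suc m))"
          using 1 Suc by (simp add: jac_diff_Suc Green_def min_def max_def algebra_simps del: sol.simps)
        also have "\<dots> = 1" using W[of "Suc m"] PS[of m] by algebra
        finally show ?thesis using 1 by simp
      qed
    qed
  qed
qed

lemma Green_l2:
  assumes "sol a b z delta0 M \<in> l2"
  shows "Green z M k \<in> l2"
proof -
  let ?g = "\<lambda>n. P z k * sol a b z delta0 M n"
  have "?g \<in> l2" using assms by (rule l2_scale)
  moreover have "(\<lambda>n. Green z M k n - ?g n) \<in> l2"
    by (intro finitely_supported_l2 finitely_supportedI[of k]) (simp add: Green_def max_def min_def)
  ultimately show ?thesis using l2_add(1) by fastforce
qed

text \<open>The limit point property at \<open>z\<close> together with the value \<open>M\<close> of the Weyl function: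
\<open>M = \<langle>R(z) delta0, delta0\<rangle>\<close>.\<close>

definition weyl :: "complex \<Rightarrow> complex \<Rightarrow> bool" where
  "weyl z M \<longleftrightarrow> Im z \<noteq> 0 \<and> P z \<notin> l2 \<and> sol a b z delta0 M \<in> l2"

text \<open>The dense range yields approximate solutions with finite support, the a priori bound makes them Cauchy,
and their limit \<open>g\<close> lies in the domain of the closure. The Green function gives another
square-summable solution of the same equation; the two differ by a multiple of \<open>P\<close>, which is not in \<open>l2\<close>.\<close>

theorem resolvent_Green:
  assumes w: "weyl z M" and u: "finitely_supported u"
  shows "resolvent (jacobi_op a b) z u = (\<lambda>n. \<Sum>k | u k \<noteq> 0. u k * Green z M k n)"
proof -
  let ?g = "\<lambda>n. \<Sum>k | u k \<noteq> 0. u k * Green z M k n"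
  have z: "Im z \<noteq> 0" and P: "P z \<notin> l2" and f: "sol a b z delta0 M \<in> l2"
    using w by (auto simp: weyl_def)
  have finu: "finite {k. u k \<noteq> 0}" using u by (simp add: finitely_supported_def)
  have sum_l2: "(\<lambda>n. \<Sum>k\<in>A. u k * Green z M k n) \<in> l2" if "finite A" for A
    using that
  proof induction
    case empty show ?case by (simp add: l2_def)
  next
    case (insert x A)
    then show ?case using l2_add(1)[OF l2_scale(1)[OF Green_l2[OF f]] insert.IH] by simp
  qed
  have g_l2: "?g \<in> l2" by (rule sum_l2[OF finu])
  have lin: "jac_diff a b z (\<lambda>n. u k * Green z M k n) n = u k * jac_diff a b z (Green z M k) n" for k n
    using jac_diff_linear[of a b z "\<lambda>_. 0" "u k" "Green z M k" n]
    by (cases n) (simp_all add: jac_diff_0 jac_diff_Suc)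
  have g_eq: "jac_diff a b z ?g n = u n" for n
  proof -
    have "jac_diff a b z ?g n = (\<Sum>k | u k \<noteq> 0. u k * (if n = k then 1 else 0))"
      unfolding jac_diff_sum lin jac_diff_Green by simp
    also have "\<dots> = u n" using finu by (simp add: if_distrib cong: if_cong)
    finally show ?thesis .
  qed
  obtain us where us: "\<And>k. finitely_supported (us k)"
    and lim: "(\<lambda>k. l2_norm (\<lambda>n. jac_diff a b z (us k) n - u n)) \<longlonglongrightarrow> 0"
    using dense_range[OF z P u] by blast
  define r where "r k n = jac_diff a b z (us k) n - u n" for k n
  have r: "r k \<in> l2" for k
    unfolding r_def using us u
    by (intro l2_diff finitely_supported_l2 jac_diff_finite)
  have lim_r: "(\<lambda>k. l2_norm (r k)) \<longlonglongrightarrow> 0" using lim by (simp add: r_def[abs_def])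
  obtain g where g: "g \<in> l2" "(\<lambda>k. l2_norm (\<lambda>n. us k n - g n)) \<longlonglongrightarrow> 0"
  proof (rule l2_complete[where us=us and e="\<lambda>k. l2_norm (r k) / \<bar>Im z\<bar>"])
    show "us k \<in> l2" for k by (rule finitely_supported_l2[OF us])
    show "(\<lambda>k. l2_norm (r k) / \<bar>Im z\<bar>) \<longlonglongrightarrow> 0" using tendsto_divide[OF lim_r tendsto_const] z by force
    fix j k
    have "jac_diff a b z (\<lambda>n. us j n - us k n) = (\<lambda>n. r j n - r k n)"
      by (rule ext) (simp add: jac_diff_diff r_def)
    then have "\<bar>Im z\<bar> * l2_norm (\<lambda>n. us j n - us k n) \<le> l2_norm (r j) + l2_norm (r k)"
      using apriori_bound[OF finitely_supported_diff[OF us us], of z j k] l2_diff(2)[OF r r, of j k]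
      by simp
    then show "l2_norm (\<lambda>n. us j n - us k n) \<le> l2_norm (r j) / \<bar>Im z\<bar> + l2_norm (r k) / \<bar>Im z\<bar>"
      using z by (simp add: field_simps)
  qed
  have pt: "(\<lambda>k. us k n) \<longlonglongrightarrow> g n" for n
  proof -
    have "(\<lambda>k. us k n - g n) \<longlonglongrightarrow> 0"
      using cmod_le_l2_norm[OF l2_diff(1)[OF finitely_supported_l2[OF us] g(1)]]
      by (intro Lim_null_comparison[OF _ g(2)] always_eventually) blast
    then show ?thesis by (simp add: LIM_zero_iff)
  qed
  have geq: "jac_diff a b z g n = u n" for n
  proof -
    have "(\<lambda>k. r k n) \<longlonglongrightarrow> 0"
      using cmod_le_l2_norm[OF r] by (intro Lim_null_comparison[OF _ lim_r] always_eventually) blast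
    then have "(\<lambda>k. jac_diff a b z (us k) n) \<longlonglongrightarrow> u n" by (simp add: r_def LIM_zero_iff)
    moreover have "(\<lambda>k. jac_diff a b z (us k) n) \<longlonglongrightarrow> jac_diff a b z g n"
      by (cases n) (auto simp: jac_diff_0 jac_diff_Suc intro!: tendsto_intros pt)
    ultimately show ?thesis using LIMSEQ_unique by blast
  qed
  have "g = ?g"
  proof -
    let ?d = "\<lambda>n. g n - ?g n"
    have d: "?d n = ?d 0 * P z n" for n
      by (rule homogeneous_unique) (simp add: jac_diff_diff geq g_eq)
    have "?d 0 = 0"
    proof (rule ccontr)
      assume nz: "?d 0 \<noteq> 0"
      have "?d \<in> l2" by (rule l2_diff[OF g(1) g_l2])
      then have "(\<lambda>n. inverse (?d 0) * ?d n) \<in> l2" by (rule l2_scale)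
      moreover have "(\<lambda>n. inverse (?d 0) * ?d n) = P z"
      proof
        fix n
        have "inverse x * y = p" if "x \<noteq> 0" "y = x * p" for x y p :: complex using that by simp
        from this[OF nz d] show "inverse (?d 0) * ?d n = P z n" .
      qed
      ultimately show False using P by simp
    qed
    then have "?d n = 0" for n using d[of n] by (simp only: mult_zero_left)
    then show ?thesis by (intro ext) simp
  qed
  let ?w = "\<lambda>n. z * g n + u n"
  have mem: "(g, ?w) \<in> jacobi_op a b"
    unfolding jacobi_op_def op_closure_def
  proof (simp only: mem_Collect_eq case_prod_conv, intro conjI)
    show "g \<in> l2" by (rule g)
    show "?w \<in> l2" by (intro l2_add l2_scale g finitely_supported_l2 u)
    have memk: "(us k, jacobi_expr a b (us k)) \<in> jacobi_min a b" for k
      using us by (auto simp: jacobi_min_def)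
    have ul2: "(\<lambda>n. us k n - g n) \<in> l2" for k by (intro l2_diff g finitely_supported_l2 us)
    have eq: "(\<lambda>n. jacobi_expr a b (us k) n - ?w n) = (\<lambda>n. r k n + z * (us k n - g n))" for k
      by (rule ext) (simp add: r_def jac_diff_def algebra_simps)
    have "(\<lambda>k. l2_norm (r k) + cmod z * l2_norm (\<lambda>n. us k n - g n)) \<longlonglongrightarrow> 0 + cmod z * 0"
      by (intro tendsto_intros lim_r g)
    then have L: "(\<lambda>k. l2_norm (r k) + cmod z * l2_norm (\<lambda>n. us k n - g n)) \<longlonglongrightarrow> 0" by simp
    have l2w: "(\<lambda>n. r k n + z * (us k n - g n)) \<in> l2" for k by (intro l2_add l2_scale r ul2)
    have le: "l2_norm (\<lambda>n. r k n + z * (us k n - g n)) \<le> l2_norm (r k) + cmod z * l2_norm (\<lambda>n. us k n - g n)" for k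
      using l2_add(2)[OF r l2_scale(1)[OF ul2], of k z k] l2_scale(2)[OF ul2, of z k] by simp
    have "(\<lambda>k. l2_norm (\<lambda>n. jacobi_expr a b (us k) n - ?w n)) \<longlonglongrightarrow> 0"
      unfolding eq
      by (rule tendsto_sandwich[OF _ _ tendsto_const L])
         (auto intro!: always_eventually l2_norm_nonneg l2w le)
    with memk g(2) show "\<exists>us ws. (\<forall>k. (us k, ws k) \<in> jacobi_min a b)
        \<and> (\<lambda>k. l2_norm (\<lambda>n. us k n - g n)) \<longlonglongrightarrow> 0
        \<and> (\<lambda>k. l2_norm (\<lambda>n. ws k n - ?w n)) \<longlonglongrightarrow> 0"
      by - (rule exI[of _ us], rule exI[of _ "\<lambda>k. jacobi_expr a b (us k)"], simp)
  qed
  have "resolvent (jacobi_op a b) z u = g"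
    unfolding resolvent_def
  proof (rule the_equality)
    show "\<exists>w. (g, w) \<in> jacobi_op a b \<and> (\<forall>n. w n - z * g n = u n)"
      using mem by (intro exI[of _ ?w]) simp
    fix f assume "\<exists>w. (f, w) \<in> jacobi_op a b \<and> (\<forall>n. w n - z * f n = u n)"
    then obtain w where w: "(f, w) \<in> jacobi_op a b" "\<And>n. w n - z * f n = u n" by blast
    show "f = g" by (rule closure_unique[OF z w mem]) simp
  qed
  with \<open>g = ?g\<close> show ?thesis by simp
qed

lemma inner_resolvent:
  assumes "weyl z M" "finitely_supported u" "finitely_supported v"
  shows "l2_inner (resolvent (jacobi_op a b) z u) v =
    (\<Sum>n | v n \<noteq> 0. (\<Sum>k | u k \<noteq> 0. u k * Green z M k n) * cnj (v n))"
  unfolding l2_inner_def resolvent_Green[OF assms(1,2)]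
  by (rule suminf_finite) (use assms(3) in \<open>auto simp: finitely_supported_def\<close>)

lemma continuous_on_Green:
  "continuous_on A M \<Longrightarrow> continuous_on A (\<lambda>z. Green z (M z) k n)"
  unfolding Green_def by (intro continuous_intros continuous_on_sol)

end

section \<open>Hyperbolic distance in the upper half-plane\<close>

text \<open>The quantity \<open>cmod (w - w') / sqrt (Im w * Im w')\<close> equals \<open>2 * sinh (d / 2)\<close> for the hyperbolic
distance \<open>d\<close> of \<open>w\<close> and \<open>w'\<close>. It is invariant under real Moebius maps and does not increase under the upward
translations \<open>w \<mapsto> w + \<i> t\<close>, hence under all maps used below. Instead of proving a triangle inequality
for it, chains of close points are used.\<close>

definition hyp_close :: "real \<Rightarrow> complex \<Rightarrow> complex \<Rightarrow> bool" where
  "hyp_close e w w' \<longleftrightarrow> 0 \<le> e \<and> 0 < Im w \<and> 0 < Im w' \<and> cmod (w - w') \<le> e * sqrt (Im w * Im w')"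

lemma hyp_close_sym: "hyp_close e w w' \<Longrightarrow> hyp_close e w' w"
  by (simp add: hyp_close_def mult.commute norm_minus_commute)

lemma hyp_close_exists: "0 < Im w \<Longrightarrow> 0 < Im w' \<Longrightarrow> \<exists>e. hyp_close e w w'"
  unfolding hyp_close_def
  by (intro exI[of _ "cmod (w - w') / sqrt (Im w * Im w')"]) simp

lemma hyp_close_Im:
  assumes "hyp_close e w w'"
  shows "Im w' \<le> exp (2 * e) * Im w"
proof -
  define x where "x = sqrt (Im w)"
  define y where "y = sqrt (Im w')"
  have x: "x > 0" "x\<^sup>2 = Im w" and y: "y > 0" "y\<^sup>2 = Im w'" and e: "e \<ge> 0"
    using assms by (auto simp: x_def y_def hyp_close_def)
  have "y\<^sup>2 - x\<^sup>2 \<le> cmod (w - w')" unfolding x y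
    using abs_Im_le_cmod[of "w - w'"] by simp
  also have "\<dots> \<le> e * (x * y)" using assms by (simp add: hyp_close_def x_def y_def real_sqrt_mult)
  finally have 1: "y\<^sup>2 - x\<^sup>2 \<le> e * (x * y)" .
  have "y \<le> (1 + e) * x"
  proof (rule ccontr)
    assume "\<not> y \<le> (1 + e) * x"
    then have gt: "y > (1 + e) * x" by simp
    have "y * y > y * ((1 + e) * x)" using gt y(1) by (rule mult_strict_left_mono)
    moreover have "y > x" using gt mult_nonneg_nonneg[OF e less_imp_le[OF x(1)]] unfolding distrib_right by linarith
    then have "x * y > x * x" using x(1) by (rule mult_strict_left_mono)
    ultimately show False using 1 by (simp add: power2_eq_square algebra_simps)
  qed
  also have "\<dots> \<le> exp e * x" using exp_ge_add_one_self[of e] x by (intro mult_right_mono) auto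
  finally have "y\<^sup>2 \<le> (exp e * x)\<^sup>2" using y by (intro power_mono) auto
  then show ?thesis unfolding power_mult_distrib x y by (simp add: exp_double)
qed

text \<open>For a Moebius map with derivative \<open>c / D\<^sup>2\<close>, where \<open>d = cmod D\<close>, distances scale by
\<open>c / (d * d')\<close> and imaginary parts at least by \<open>c / d\<^sup>2\<close>, so the factors cancel.\<close>

lemma hyp_close_transform:
  assumes c: "hyp_close e w w'" and pos: "c > 0" "d > 0" "d' > 0"
    and n: "cmod (u - u') = c * cmod (w - w') / (d * d')"
    and I: "Im u \<ge> c * Im w / d\<^sup>2" "Im u' \<ge> c * Im w' / d'\<^sup>2"
  shows "hyp_close e u u'"
proof -
  have w: "0 < Im w" "0 < Im w'" "0 \<le> e" "cmod (w - w') \<le> e * sqrt (Im w * Im w')"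
    using c by (auto simp: hyp_close_def)
  have p: "c * Im w / d\<^sup>2 > 0" "c * Im w' / d'\<^sup>2 > 0" using w pos by auto
  have "cmod (u - u') \<le> c * (e * sqrt (Im w * Im w')) / (d * d')"
    unfolding n using pos w by (intro divide_right_mono mult_left_mono) auto
  also have "\<dots> = e * sqrt ((c * Im w / d\<^sup>2) * (c * Im w' / d'\<^sup>2))"
    using pos by (simp add: real_sqrt_mult real_sqrt_divide)
  also have "\<dots> \<le> e * sqrt (Im u * Im u')"
    using w p I by (intro mult_left_mono real_sqrt_le_mono mult_mono) auto
  finally show ?thesis using p I w by (auto simp: hyp_close_def)
qed

lemma Im_inverse_complex: "Im (1 / x) = - Im x / (cmod x)\<^sup>2"
  unfolding Im_divide cmod_power2 by simp

text \<open>Paths in the half-plane with their total length: a substitute for the triangle inequality.\<close>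

inductive hyp_chain :: "real \<Rightarrow> complex \<Rightarrow> complex \<Rightarrow> bool" where
  hyp_chain_refl: "hyp_chain 0 w w"
| hyp_chain_step: "hyp_close e w w' \<Longrightarrow> hyp_chain l w' w'' \<Longrightarrow> hyp_chain (e + l) w w''"

lemma hyp_chain_Im: "hyp_chain l w w' \<Longrightarrow> Im w' \<le> exp (2 * l) * Im w"
proof (induction rule: hyp_chain.induct)
  case (hyp_chain_step e w w' l w'')
  have "Im w'' \<le> exp (2 * l) * (exp (2 * e) * Im w)"
    using hyp_chain_step.IH hyp_close_Im[OF hyp_chain_step.hyps(1)] by (meson exp_ge_zero mult_left_mono order_trans)
  then show ?case by (simp add: exp_add distrib_left mult_ac)
qed simp

lemma hyp_chain_map:
  assumes "\<And>e w w'. hyp_close e w w' \<Longrightarrow> hyp_close e (g w) (g w')"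
  shows "hyp_chain l w w' \<Longrightarrow> hyp_chain l (g w) (g w')"
  by (induction rule: hyp_chain.induct) (auto intro: hyp_chain.intros assms)

section \<open>Weyl functions by composition of Moebius maps\<close>

context jacobi
begin

text \<open>If \<open>m\<^sub>k\<close> denotes the Weyl function of the matrix with the first \<open>k\<close> rows and columns deleted,
then \<open>m\<^sub>k = weyl_map k z m\<^sub>k\<^sub>+\<^sub>1\<close>. Backward steps preserve the upper half-plane for \<open>Im z \<ge> 0\<close>, and the
forward steps \<open>weyl_inv\<close> preserve it for \<open>Im z \<le> 0\<close>.\<close>

definition weyl_map :: "nat \<Rightarrow> complex \<Rightarrow> complex \<Rightarrow> complex" where
  "weyl_map k z w = 1 / (of_real (b k) - z - of_real ((a k)\<^sup>2) * w)"

definition weyl_inv :: "nat \<Rightarrow> complex \<Rightarrow> complex \<Rightarrow> complex" where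
  "weyl_inv k z w = (of_real (b k) - z - 1 / w) / of_real ((a k)\<^sup>2)"

fun weyl_comp :: "nat \<Rightarrow> complex \<Rightarrow> complex \<Rightarrow> complex" where
  "weyl_comp 0 z w = w"
| "weyl_comp (Suc n) z w = weyl_comp n z (weyl_map n z w)"

lemma weyl_denom_Im:
  assumes "Im z \<ge> 0" "Im w > 0"
  shows "Im (of_real (b k) - z - of_real ((a k)\<^sup>2) * w) < 0"
proof -
  have "0 < (a k)\<^sup>2 * Im w" using assms a_pos[of k] by simp
  then have "- Im z - (a k)\<^sup>2 * Im w < 0" using assms by linarith
  then show ?thesis by (simp del: of_real_power)
qed

lemma weyl_denom_nz:
  assumes "Im z \<ge> 0" "Im w > 0"
  shows "of_real (b k) - z - of_real ((a k)\<^sup>2) * w \<noteq> 0"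
  using weyl_denom_Im[OF assms, of k] by (metis less_irrefl zero_complex.sel(2))

lemma hyp_close_weyl_map:
  assumes z: "Im z \<ge> 0" and c: "hyp_close e w w'"
  shows "hyp_close e (weyl_map k z w) (weyl_map k z w')"
proof -
  define D where "D w = of_real (b k) - z - of_real ((a k)\<^sup>2) * w" for w
  have w: "Im w > 0" "Im w' > 0" using c by (auto simp: hyp_close_def)
  have nz: "D w \<noteq> 0" "D w' \<noteq> 0" unfolding D_def using weyl_denom_nz z w by blast+
  have I: "Im (1 / D v) \<ge> (a k)\<^sup>2 * Im v / (cmod (D v))\<^sup>2" for v
    unfolding Im_inverse_complex by (rule divide_right_mono) (use z in \<open>simp_all add: D_def del: of_real_power\<close>)
  have "1 / D w - 1 / D w' = of_real ((a k)\<^sup>2) * (w - w') / (D w * D w')"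
    using nz by (simp add: field_simps) (simp add: D_def algebra_simps)
  then have "cmod (1 / D w - 1 / D w') = (a k)\<^sup>2 * cmod (w - w') / (cmod (D w) * cmod (D w'))"
    by (simp add: norm_divide norm_mult del: of_real_power)
  from hyp_close_transform[OF c _ _ _ this I I] nz a_pos[of k] show ?thesis
    by (simp add: weyl_map_def D_def)
qed

lemma hyp_close_weyl_inv:
  assumes z: "Im z \<le> 0" and c: "hyp_close e w w'"
  shows "hyp_close e (weyl_inv k z w) (weyl_inv k z w')"
proof -
  let ?A = "(a k)\<^sup>2"
  have w: "Im w > 0" "Im w' > 0" using c by (auto simp: hyp_close_def)
  then have nz: "w \<noteq> 0" "w' \<noteq> 0" by auto
  have A: "?A > 0" using a_pos[of k] by simp
  have I: "Im (weyl_inv k z v) \<ge> 1 / ?A * Im v / (cmod v)\<^sup>2" for v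
  proof -
    have "Im (weyl_inv k z v) = (- Im z + Im v / (cmod v)\<^sup>2) / ?A"
      unfolding weyl_inv_def Im_divide_of_real minus_complex.sel Im_inverse_complex by simp
    also have "\<dots> \<ge> (Im v / (cmod v)\<^sup>2) / ?A" using z A by (intro divide_right_mono) auto
    finally show ?thesis by (simp add: mult_ac)
  qed
  have "weyl_inv k z w - weyl_inv k z w' = (w - w') / (of_real ?A * (w * w'))"
    unfolding weyl_inv_def using nz A by (simp add: field_simps del: of_real_power)
  then have "cmod (weyl_inv k z w - weyl_inv k z w') = 1 / ?A * cmod (w - w') / (cmod w * cmod w')"
    using A by (simp add: norm_divide norm_mult del: of_real_power)
  from hyp_close_transform[OF c _ _ _ this I I] nz A show ?thesis by simp
qed

lemma hyp_close_weyl_comp: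
  "Im z \<ge> 0 \<Longrightarrow> hyp_close e w w' \<Longrightarrow> hyp_close e (weyl_comp n z w) (weyl_comp n z w')"
  by (induction n arbitrary: w w') (auto intro: hyp_close_weyl_map)

lemma continuous_on_weyl_comp:
  assumes "continuous_on U g" "\<And>z. z \<in> U \<Longrightarrow> Im z \<ge> 0" "\<And>z. z \<in> U \<Longrightarrow> Im (g z) > 0"
  shows "continuous_on U (\<lambda>z. weyl_comp n z (g z))"
  using assms(1,3)
proof (induction n arbitrary: g)
  case (Suc n)
  have nz: "of_real (b n) - z - of_real ((a n)\<^sup>2) * g z \<noteq> 0" if "z \<in> U" for z
    using that assms(2) Suc.prems(2) weyl_denom_nz by blast
  have "continuous_on U (\<lambda>z. weyl_map n z (g z))"
    unfolding weyl_map_def using nz by (intro continuous_intros Suc.prems(1)) auto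
  moreover have "Im (weyl_map n z (g z)) > 0" if "z \<in> U" for z
    using hyp_close_weyl_map[of z 0 "g z" "g z" n] that assms(2) Suc.prems(2) by (simp add: hyp_close_def)
  ultimately show ?case using Suc.IH by simp
qed simp

text \<open>Prescribing the tail value \<open>w\<close> at level \<open>n + 1\<close> amounts to prescribing the logarithmic step
\<open>f (n + 1) / f n = - a n * w\<close> of the solution.\<close>

lemma sol_weyl_comp:
  assumes z: "Im z \<ge> 0" and "Im w > 0"
  shows "sol a b z delta0 (weyl_comp (Suc n) z w) (Suc n)
       = - of_real (a n) * w * sol a b z delta0 (weyl_comp (Suc n) z w) n"
  using assms(2)
proof (induction n arbitrary: w)
  case 0
  let ?D = "of_real (b 0) - z - of_real ((a 0)\<^sup>2) * w"
  have D: "?D \<noteq> 0" by (rule weyl_denom_nz[OF z 0])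
  have "1 - (of_real (b 0) - z) * (1 / ?D) = - (of_real ((a 0)\<^sup>2) * w) * (1 / ?D)"
    using D by (simp add: divide_simps)
  then have "(1 - (of_real (b 0) - z) * (1 / ?D)) / of_real (a 0) = - of_real (a 0) * w * (1 / ?D)"
    by (simp add: power2_eq_square)
  then show ?case by (simp add: weyl_map_def)
next
  case (Suc n)
  let ?D = "of_real (b (Suc n)) - z - of_real ((a (Suc n))\<^sup>2) * w"
  let ?w = "weyl_map (Suc n) z w"
  define f where "f = sol a b z delta0 (weyl_comp (Suc (Suc n)) z w)"
  have D: "?D \<noteq> 0" by (rule weyl_denom_nz[OF z Suc.prems])
  have "Im ?w > 0"
    using hyp_close_weyl_map[OF z, of 0 w w "Suc n"] Suc.prems by (simp add: hyp_close_def)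
  from Suc.IH[OF this] have "f (Suc n) = - of_real (a n) * ?w * f n" by (simp add: f_def)
  then have an: "of_real (a n) * f n = - ?D * f (Suc n)"
    using D by (simp add: weyl_map_def field_simps)
  have "f (Suc (Suc n)) = (- ((of_real (b (Suc n)) - z) * f (Suc n)) - of_real (a n) * f n) / of_real (a (Suc n))"
    by (simp add: f_def)
  also have "\<dots> = - of_real (a (Suc n)) * w * f (Suc n)"
    unfolding an by (simp add: field_simps power2_eq_square)
  finally show ?case unfolding f_def .
qed

lemma energy_bound:
  assumes z: "Im z > 0" and w: "Im w > 0" and m_def: "m = weyl_comp (Suc n) z w"
  shows "Im z * (\<Sum>k\<le>n. (cmod (sol a b z delta0 m k))\<^sup>2) \<le> Im m"
proof -
  let ?f = "sol a b z delta0 m"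
  have "(\<Sum>k\<le>n. Im (cnj (?f k) * jac_diff a b z ?f k)) = (\<Sum>k\<le>n. if k = 0 then - Im m else 0)"
    by (rule sum.cong) auto
  then have "Im z * (\<Sum>k\<le>n. (cmod (?f k))\<^sup>2) = a n * Im (cnj (?f n) * ?f (Suc n)) + Im m"
    using energy_identity[where f="?f" and z=z and a=a and b=b and n=n] by simp
  moreover have "Im (cnj (?f n) * ?f (Suc n)) \<le> 0"
  proof -
    have "?f (Suc n) = - of_real (a n) * w * ?f n"
      unfolding m_def using sol_weyl_comp z w by simp
    then have "cnj (?f n) * ?f (Suc n) = of_real (- a n * (cmod (?f n))\<^sup>2) * w"
      using complex_norm_square[of "?f n"] by (simp add: mult_ac)
    then have "Im (cnj (?f n) * ?f (Suc n)) = - a n * (cmod (?f n))\<^sup>2 * Im w"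
      by (simp del: of_real_mult of_real_minus of_real_power)
    moreover have "a n * (cmod (?f n))\<^sup>2 * Im w \<ge> 0" using a_pos[of n] w by simp
    ultimately show ?thesis by simp
  qed
  then have "a n * Im (cnj (?f n) * ?f (Suc n)) \<le> 0" using a_pos[of n] by (simp add: mult_nonneg_nonpos)
  ultimately show ?thesis by linarith
qed

text \<open>The energy bound for the approximants is uniform in \<open>n\<close> and passes to the limit on every finite
section.\<close>

lemma weyl_limit_l2:
  assumes z: "Im z > 0" and w: "\<And>n. n \<ge> N \<Longrightarrow> Im (w n) > 0"
    and lim: "(\<lambda>n. weyl_comp (Suc n) z (w n)) \<longlonglongrightarrow> M"
  shows "sol a b z delta0 M \<in> l2"
proof -
  let ?m = "\<lambda>n. weyl_comp (Suc n) z (w n)"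
  have "(\<Sum>k<K. (cmod (sol a b z delta0 M k))\<^sup>2) \<le> Im M / Im z" for K
  proof (rule LIMSEQ_le)
    have "(\<lambda>n. sol a b z delta0 (?m n) k) \<longlonglongrightarrow> sol a b z delta0 M k" for k
      unfolding sol_shift[of z delta0 "?m _" k] sol_shift[of z delta0 M k]
      by (intro tendsto_intros lim)
    then show "(\<lambda>n. \<Sum>k<K. (cmod (sol a b z delta0 (?m n) k))\<^sup>2) \<longlonglongrightarrow> (\<Sum>k<K. (cmod (sol a b z delta0 M k))\<^sup>2)"
      by (intro tendsto_intros)
    show "(\<lambda>n. Im (?m n) / Im z) \<longlonglongrightarrow> Im M / Im z"
      using z by (intro tendsto_intros lim) auto
    show "\<exists>n0. \<forall>n\<ge>n0. (\<Sum>k<K. (cmod (sol a b z delta0 (?m n) k))\<^sup>2) \<le> Im (?m n) / Im z"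
    proof (intro exI allI impI)
      fix n assume n: "n \<ge> max N K"
      have "(\<Sum>k<K. (cmod (sol a b z delta0 (?m n) k))\<^sup>2) \<le> (\<Sum>k\<le>n. (cmod (sol a b z delta0 (?m n) k))\<^sup>2)"
        by (rule sum_mono2) (use n in auto)
      also have "\<dots> \<le> Im (?m n) / Im z"
        using energy_bound[OF z w refl, of n n] n z by (simp add: field_simps)
      finally show "(\<Sum>k<K. (cmod (sol a b z delta0 (?m n) k))\<^sup>2) \<le> Im (?m n) / Im z" .
    qed
  qed
  then have "summable (\<lambda>k. (cmod (sol a b z delta0 M k))\<^sup>2)"
    by (intro summableI_nonneg_bounded) auto
  then show ?thesis by (simp add: l2_def)
qed

text \<open>Suppose that the points \<open>Z n z\<close> almost satisfy the backward recursion, with hyperbolic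
errors that are summable uniformly in \<open>z\<close>. As the Weyl maps do not increase the hyperbolic distance, even for real \<open>z\<close>, the
images of \<open>Z n z\<close> at level \<open>0\<close> move by at most \<open>e n\<close> when \<open>n\<close> grows by one. Their imaginary parts then stay
bounded, hyperbolic bounds become Euclidean ones, and the Weierstrass test applies.\<close>

lemma weyl_limit_continuous:
  assumes U: "compact U" "\<And>z. z \<in> U \<Longrightarrow> Im z \<ge> 0"
    and e: "summable e"
    and cl: "\<And>n z. n \<ge> N \<Longrightarrow> z \<in> U \<Longrightarrow> hyp_close (e n) (Z n z) (weyl_map (Suc n) z (Z (Suc n) z))"
    and cont: "\<And>n. n \<ge> N \<Longrightarrow> continuous_on U (Z n)"
  shows "\<exists>M. continuous_on U M \<and> (\<forall>z\<in>U. (\<lambda>n. weyl_comp (Suc n) z (Z n z)) \<longlonglongrightarrow> M z)"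
proof (cases "U = {}")
  case False
  define W where "W n z = weyl_comp (Suc n) z (Z n z)" for n z
  have ZI: "Im (Z n z) > 0" if "n \<ge> N" "z \<in> U" for n z
    using cl[OF that] by (simp add: hyp_close_def)
  have Wcont: "continuous_on U (W n)" if "n \<ge> N" for n
    unfolding W_def[abs_def] using that by (intro continuous_on_weyl_comp cont U(2) ZI)
  have e0: "e n \<ge> 0" if "n \<ge> N" for n
    using cl[OF that] False by (auto simp: hyp_close_def)
  have Wcl: "hyp_close (e n) (W n z) (W (Suc n) z)" if "n \<ge> N" "z \<in> U" for n z
    using hyp_close_weyl_comp[OF U(2) cl, OF that(2) that, of "Suc n"] by (simp add: W_def)
  have WI: "Im (W n z) > 0" if "n \<ge> N" "z \<in> U" for n z
    using Wcl[OF that] by (simp add: hyp_close_def)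
  define S where "S = (\<Sum>i. e (N + i))"
  have sume: "summable (\<lambda>i. e (N + i))" using e summable_iff_shift[of e N] by (simp add: add.commute)
  have partial: "(\<Sum>i<n. e (N + i)) \<le> S" for n
    unfolding S_def using sume by (intro sum_le_suminf) (auto intro: e0)
  obtain B where B: "\<And>z. z \<in> U \<Longrightarrow> cmod (W N z) \<le> B"
  proof -
    have "compact (W N ` U)" using Wcont[of N] U(1) by (intro compact_continuous_image) auto
    then have "bounded (W N ` U)" by (rule compact_imp_bounded)
    then show ?thesis using that unfolding bounded_iff by auto
  qed
  \<comment> \<open>\<open>K\<close> bounds all imaginary parts: each step multiplies them by at most \<open>exp (2 * e n)\<close>\<close>
  define K where "K = exp (2 * S) * B"
  have IK: "Im (W (N + i) z) \<le> K" if "z \<in> U" for i z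
  proof -
    have "Im (W (N + i) z) \<le> exp (2 * (\<Sum>j<i. e (N + j))) * Im (W N z)"
    proof (induction i)
      case (Suc i)
      have "Im (W (N + Suc i) z) \<le> exp (2 * e (N + i)) * Im (W (N + i) z)"
        using hyp_close_Im[OF Wcl[of "N + i" z]] that by simp
      also have "\<dots> \<le> exp (2 * e (N + i)) * (exp (2 * (\<Sum>j<i. e (N + j))) * Im (W N z))"
        by (intro mult_left_mono Suc) auto
      finally show ?case by (simp add: exp_add distrib_left mult_ac)
    qed simp
    also have "\<dots> \<le> K" unfolding K_def
      using partial[of i] B[OF that] abs_Im_le_cmod[of "W N z"] WI[of N z] that
      by (intro mult_mono) auto
    finally show ?thesis .
  qed
  have step: "cmod (W (Suc (N + i)) z - W (N + i) z) \<le> e (N + i) * K" if "z \<in> U" for i z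
  proof -
    have pos: "Im (W (N + i) z) > 0" "Im (W (Suc (N + i)) z) > 0" using WI that by auto
    have K0: "K > 0" using IK[OF that, of i] pos by linarith
    have "sqrt (Im (W (N + i) z) * Im (W (Suc (N + i)) z)) \<le> sqrt (K * K)"
      using pos IK[OF that, of i] IK[OF that, of "Suc i"] K0 by (intro real_sqrt_le_mono mult_mono) auto
    then have "sqrt (Im (W (N + i) z) * Im (W (Suc (N + i)) z)) \<le> K" using K0 by simp
    then have "e (N + i) * sqrt (Im (W (N + i) z) * Im (W (Suc (N + i)) z)) \<le> e (N + i) * K"
      by (intro mult_left_mono e0) auto
    then show ?thesis using Wcl[of "N + i" z] that by (auto simp: hyp_close_def norm_minus_commute)
  qed
  let ?d = "\<lambda>i z. W (Suc (N + i)) z - W (N + i) z"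
  have tele: "(\<Sum>i<n. ?d i z) = W (N + n) z - W N z" for n z
    by (induction n) auto
  have ul: "uniform_limit U (\<lambda>n z. \<Sum>i<n. ?d i z) (\<lambda>z. \<Sum>i. ?d i z) sequentially"
    by (rule Weierstrass_m_test[where M="\<lambda>i. e (N + i) * K"])
       (use step summable_mult2[OF sume] in auto)
  have "continuous_on U (\<lambda>z. \<Sum>i. ?d i z)"
    by (rule uniform_limit_theorem[OF _ ul])
       (auto simp: tele intro!: always_eventually continuous_intros Wcont)
  then have "continuous_on U (\<lambda>z. W N z + (\<Sum>i. ?d i z))"
    by (intro continuous_intros Wcont) auto
  moreover have "(\<lambda>n. W n z) \<longlonglongrightarrow> W N z + (\<Sum>i. ?d i z)" if "z \<in> U" for z
  proof -
    have "(\<lambda>n. W (N + n) z - W N z) \<longlonglongrightarrow> (\<Sum>i. ?d i z)"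
      using tendsto_uniform_limitI[OF ul that] by (simp add: tele)
    then have "(\<lambda>n. W N z + (W (N + n) z - W N z)) \<longlonglongrightarrow> W N z + (\<Sum>i. ?d i z)"
      by (intro tendsto_intros)
    then have "(\<lambda>n. W (n + N) z) \<longlonglongrightarrow> W N z + (\<Sum>i. ?d i z)" by (simp add: add.commute)
    then show ?thesis by (rule LIMSEQ_offset)
  qed
  ultimately show ?thesis unfolding W_def by blast
qed auto

text \<open>The limit point property. For \<open>Im z < 0\<close> the scaled quotients \<open>\<mu> n\<close> of consecutive polynomials stay in the upper
half-plane and follow the forward recursion, which does not increase hyperbolic distances; so if \<open>Z\<close> follows this recursion
up to summable errors, \<open>\<mu> n\<close> stays at bounded distance from \<open>Z n\<close>, and \<open>Im (\<mu> n)\<close> is at most a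
constant times \<open>s n / (a n)\<^sup>2\<close>. On the other hand the energy identity expresses \<open>Im (\<mu> n)\<close> as \<open>- Im z * (\<Sum>k\<le>n. (cmod (P z k))\<^sup>2)\<close> divided by
\<open>(a n)\<^sup>2 * (cmod (P z n))\<^sup>2\<close>. Together, \<open>(cmod (P z n))\<^sup>2\<close> is at least a multiple of \<open>1 / s n\<close>.\<close>

lemma P_not_l2:
  assumes z: "Im z < 0" and e: "summable e"
    and cl: "\<And>n. n \<ge> N \<Longrightarrow> hyp_close (e n) (weyl_inv (Suc n) z (Z n)) (Z (Suc n))"
    and Zb: "\<And>n. n \<ge> N \<Longrightarrow> Im (Z n) \<le> s n / (a n)\<^sup>2"
    and s: "\<And>n. n \<ge> N \<Longrightarrow> s n > 0" "\<not> summable (\<lambda>n. 1 / s n)"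
    and ZN: "Im (Z N) > 0"
  shows "P z \<notin> l2"
proof
  assume l2: "P z \<in> l2"
  \<comment> \<open>\<open>- P (n + 1) / (a n * P n)\<close> plays the role of the tail Weyl function for the solution \<open>P\<close>\<close>
  define \<mu> where "\<mu> n = - P z (Suc n) / (of_real (a n) * P z n)" for n
  have nz: "P z n \<noteq> 0" for n using P_nonzero z by simp
  have Im_mu: "Im (\<mu> n) = - Im z * (\<Sum>k\<le>n. (cmod (P z k))\<^sup>2) / ((a n)\<^sup>2 * (cmod (P z n))\<^sup>2)" for n
  proof -
    have "\<mu> n = - (cnj (P z n) * P z (Suc n)) / (of_real (a n) * of_real ((cmod (P z n))\<^sup>2))"
      unfolding \<mu>_def complex_norm_square using nz[of n] by simp
    also have "\<dots> = - (cnj (P z n) * P z (Suc n)) / of_real (a n * (cmod (P z n))\<^sup>2)" by simp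
    finally have "Im (\<mu> n) = - Im (cnj (P z n) * P z (Suc n)) / (a n * (cmod (P z n))\<^sup>2)"
      by (simp only: Im_divide_of_real uminus_complex.sel)
    also have "\<dots> = - (a n * Im (cnj (P z n) * P z (Suc n))) / ((a n)\<^sup>2 * (cmod (P z n))\<^sup>2)"
    proof -
      have "- i / (a n * x) = - (a n * i) / ((a n)\<^sup>2 * x)" for i x :: real
        by (simp add: power2_eq_square)
      then show ?thesis .
    qed
    finally show ?thesis unfolding energy_P by simp
  qed
  have mu_pos: "Im (\<mu> n) > 0" for n
    unfolding Im_mu using z sum_P_ge_1[where n=n and z=z] nz[of n] a_pos[of n]
    by (intro divide_pos_pos mult_pos_pos) auto
  have mu_Suc: "\<mu> (Suc n) = weyl_inv (Suc n) z (\<mu> n)" for n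
    unfolding \<mu>_def weyl_inv_def using nz[of n] nz[of "Suc n"]
    by (simp add: field_simps power2_eq_square)
  obtain e0 where e0: "hyp_close e0 (Z N) (\<mu> N)" using hyp_close_exists[OF ZN mu_pos] by blast
  have ch: "hyp_chain (e0 + (\<Sum>i<n. e (N + i))) (Z (N + n)) (\<mu> (N + n))" for n
  proof (induction n)
    case 0
    show ?case using hyp_chain_step[OF e0 hyp_chain_refl] by simp
  next
    case (Suc n)
    have "hyp_chain (e0 + (\<Sum>i<n. e (N + i))) (weyl_inv (Suc (N + n)) z (Z (N + n))) (\<mu> (Suc (N + n)))"
      unfolding mu_Suc by (rule hyp_chain_map[OF _ Suc]) (use z in \<open>auto intro: hyp_close_weyl_inv\<close>)
    from hyp_chain_step[OF hyp_close_sym[OF cl] this] show ?case by (simp add: add_ac)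
  qed
  have e_nn: "e (N + i) \<ge> 0" for i using cl[of "N + i"] by (simp add: hyp_close_def)
  have sume: "summable (\<lambda>i. e (N + i))" using e summable_iff_shift[of e N] by (simp add: add.commute)
  define K where "K = exp (2 * (e0 + (\<Sum>i. e (N + i))))"
  have bound: "1 / s (n + N) \<le> K / - Im z * (cmod (P z (n + N)))\<^sup>2" for n
  proof -
    let ?n = "N + n"
    have a: "(a ?n)\<^sup>2 > 0" "(cmod (P z ?n))\<^sup>2 > 0" "s ?n > 0"
      using a_pos[of ?n] nz[of ?n] s(1)[of ?n] by auto
    have "Im (\<mu> ?n) \<le> exp (2 * (e0 + (\<Sum>i<n. e (N + i)))) * Im (Z ?n)"
      by (rule hyp_chain_Im[OF ch])
    also have "\<dots> \<le> K * (s ?n / (a ?n)\<^sup>2)" unfolding K_def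
    proof (rule mult_mono)
      show "exp (2 * (e0 + (\<Sum>i<n. e (N + i)))) \<le> exp (2 * (e0 + (\<Sum>i. e (N + i))))"
        using sum_le_suminf[OF sume, of "{..<n}"] e_nn by simp
      show "Im (Z ?n) \<le> s ?n / (a ?n)\<^sup>2" by (rule Zb) simp
      show "Im (Z ?n) \<ge> 0" using cl[of ?n] cl[of "?n - 1"] ZN by (cases n) (auto simp: hyp_close_def)
    qed auto
    finally have "- Im z * (\<Sum>k\<le>?n. (cmod (P z k))\<^sup>2) \<le> K * s ?n * (cmod (P z ?n))\<^sup>2"
      unfolding Im_mu using a by (simp add: field_simps)
    moreover have "- Im z * 1 \<le> - Im z * (\<Sum>k\<le>?n. (cmod (P z k))\<^sup>2)"
      using z by (intro mult_left_mono sum_P_ge_1) auto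
    ultimately have "- Im z \<le> K * s ?n * (cmod (P z ?n))\<^sup>2" by linarith
    then show ?thesis using a z by (simp add: field_simps add.commute)
  qed
  have "summable (\<lambda>n. K / - Im z * (cmod (P z (n + N)))\<^sup>2)"
    using l2 unfolding l2_def by (intro summable_mult) (simp add: summable_iff_shift[where k=N and f="\<lambda>n. (cmod (P z n))\<^sup>2"])
  then have "summable (\<lambda>n. 1 / s (n + N))"
    by (rule summable_comparison_test') (use bound s(1) in \<open>auto simp: less_imp_le\<close>)
  then have "summable (\<lambda>n. 1 / s n)"
    by (subst (asm) summable_iff_shift[where k=N and f="\<lambda>n. 1 / s n"])
  then show False using s(2) by simp
qed

end

section \<open>Sequences of uniformly bounded variation\<close>

text \<open>Uniformity in \<open>z\<close> is expressed by a common summable majorant of the differences. Only its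
existence matters: the class is closed under sums, products and square roots, so no explicit rates are needed for \<open>X\<close> below.\<close>

definition unif_bv :: "complex set \<Rightarrow> nat \<Rightarrow> (nat \<Rightarrow> complex \<Rightarrow> complex) \<Rightarrow> bool" where
  "unif_bv U N g \<longleftrightarrow> (\<exists>K h. summable h \<and>
     (\<forall>n\<ge>N. \<forall>z\<in>U. cmod (g n z) \<le> K \<and> cmod (g (Suc n) z - g n z) \<le> h n))"

lemma unif_bvE:
  assumes "unif_bv U N g"
  obtains K h where "summable h" "\<And>n. n \<ge> N \<Longrightarrow> 0 \<le> h n" "K \<ge> 0"
    "\<And>n z. n \<ge> N \<Longrightarrow> z \<in> U \<Longrightarrow> cmod (g n z) \<le> K"
    "\<And>n z. n \<ge> N \<Longrightarrow> z \<in> U \<Longrightarrow> cmod (g (Suc n) z - g n z) \<le> h n"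
proof -
  obtain K h where *: "summable h"
    "\<And>n z. n \<ge> N \<Longrightarrow> z \<in> U \<Longrightarrow> cmod (g n z) \<le> K"
    "\<And>n z. n \<ge> N \<Longrightarrow> z \<in> U \<Longrightarrow> cmod (g (Suc n) z - g n z) \<le> h n"
    using assms unfolding unif_bv_def by blast
  show ?thesis
  proof (cases "U = {}")
    case True
    show ?thesis by (rule that[of "\<lambda>_. 0" 0]) (auto simp: True)
  next
    case False
    then obtain z where z: "z \<in> U" by blast
    show ?thesis
    proof (rule that[OF *(1)])
      show "0 \<le> h n" if "n \<ge> N" for n using *(3)[OF that z] norm_ge_zero order_trans by blast
      show "0 \<le> K" using *(2)[OF order_refl z] norm_ge_zero order_trans by blast
    qed (use * in auto)
  qed
qed

lemma unif_bv_mono: "unif_bv U N g \<Longrightarrow> N \<le> N' \<Longrightarrow> unif_bv U N' g"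
  unfolding unif_bv_def by (meson order_trans)

lemma unif_bv_add:
  assumes "unif_bv U N f" "unif_bv U N g"
  shows "unif_bv U N (\<lambda>n z. f n z + g n z)"
proof -
  obtain K h where 1: "summable h" "\<And>n. n \<ge> N \<Longrightarrow> 0 \<le> h n" "K \<ge> 0"
    "\<And>n z. n \<ge> N \<Longrightarrow> z \<in> U \<Longrightarrow> cmod (f n z) \<le> K"
    "\<And>n z. n \<ge> N \<Longrightarrow> z \<in> U \<Longrightarrow> cmod (f (Suc n) z - f n z) \<le> h n"
    using unif_bvE[OF assms(1)] by metis
  obtain K' h' where 2: "summable h'" "\<And>n. n \<ge> N \<Longrightarrow> 0 \<le> h' n" "K' \<ge> 0"
    "\<And>n z. n \<ge> N \<Longrightarrow> z \<in> U \<Longrightarrow> cmod (g n z) \<le> K'"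
    "\<And>n z. n \<ge> N \<Longrightarrow> z \<in> U \<Longrightarrow> cmod (g (Suc n) z - g n z) \<le> h' n"
    using unif_bvE[OF assms(2)] by metis
  show ?thesis unfolding unif_bv_def
  proof (intro exI conjI allI impI ballI)
    show "summable (\<lambda>n. h n + h' n)" by (intro summable_add 1 2)
    fix n z assume n: "n \<ge> N" "z \<in> U"
    show "cmod (f n z + g n z) \<le> K + K'"
      using 1(4)[OF n] 2(4)[OF n] norm_triangle_ineq[of "f n z" "g n z"] by linarith
    have "cmod (f (Suc n) z + g (Suc n) z - (f n z + g n z))
        \<le> cmod (f (Suc n) z - f n z) + cmod (g (Suc n) z - g n z)"
      using norm_triangle_ineq[of "f (Suc n) z - f n z" "g (Suc n) z - g n z"] by (simp add: algebra_simps)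
    then show "cmod (f (Suc n) z + g (Suc n) z - (f n z + g n z)) \<le> h n + h' n"
      using 1(5)[OF n] 2(5)[OF n] by linarith
  qed
qed

lemma unif_bv_mult:
  assumes "unif_bv U N f" "unif_bv U N g"
  shows "unif_bv U N (\<lambda>n z. f n z * g n z)"
proof -
  obtain K h where 1: "summable h" "\<And>n. n \<ge> N \<Longrightarrow> 0 \<le> h n" "K \<ge> 0"
    "\<And>n z. n \<ge> N \<Longrightarrow> z \<in> U \<Longrightarrow> cmod (f n z) \<le> K"
    "\<And>n z. n \<ge> N \<Longrightarrow> z \<in> U \<Longrightarrow> cmod (f (Suc n) z - f n z) \<le> h n"
    using unif_bvE[OF assms(1)] by metis
  obtain K' h' where 2: "summable h'" "\<And>n. n \<ge> N \<Longrightarrow> 0 \<le> h' n" "K' \<ge> 0"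
    "\<And>n z. n \<ge> N \<Longrightarrow> z \<in> U \<Longrightarrow> cmod (g n z) \<le> K'"
    "\<And>n z. n \<ge> N \<Longrightarrow> z \<in> U \<Longrightarrow> cmod (g (Suc n) z - g n z) \<le> h' n"
    using unif_bvE[OF assms(2)] by metis
  show ?thesis unfolding unif_bv_def
  proof (intro exI conjI allI impI ballI)
    show "summable (\<lambda>n. K' * h n + K * h' n)" by (intro summable_add summable_mult 1 2)
    fix n z assume n: "n \<ge> N" "z \<in> U"
    show "cmod (f n z * g n z) \<le> K * K'"
      unfolding norm_mult using 1(4)[OF n] 2(4)[OF n] 1(3) by (intro mult_mono) auto
    have "f (Suc n) z * g (Suc n) z - f n z * g n z
        = (f (Suc n) z - f n z) * g (Suc n) z + f n z * (g (Suc n) z - g n z)"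
      by (simp add: algebra_simps)
    then have "cmod (f (Suc n) z * g (Suc n) z - f n z * g n z)
        \<le> cmod (f (Suc n) z - f n z) * cmod (g (Suc n) z) + cmod (f n z) * cmod (g (Suc n) z - g n z)"
      by (metis norm_triangle_ineq norm_mult)
    also have "\<dots> \<le> h n * K' + K * h' n"
      using 1(2)[OF n(1)] 1(3) 1(4)[OF n] 1(5)[OF n] 2(4)[of "Suc n" z] 2(5)[OF n] n
      by (intro add_mono mult_mono) auto
    finally show "cmod (f (Suc n) z * g (Suc n) z - f n z * g n z) \<le> K' * h n + K * h' n"
      by (simp add: mult.commute)
  qed
qed

lemma unif_bv_const:
  assumes "\<And>z. z \<in> U \<Longrightarrow> cmod (c z) \<le> K"
  shows "unif_bv U N (\<lambda>n z. c z)"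
  unfolding unif_bv_def using assms by (intro exI[of _ K] exI[of _ "\<lambda>_. 0"]) auto

lemma unif_bv_minus: "unif_bv U N g \<Longrightarrow> unif_bv U N (\<lambda>n z. - g n z)"
  using unif_bv_mult[OF unif_bv_const[of U "\<lambda>_. -1" 1], of N g] by simp

lemma unif_bv_diff: "unif_bv U N f \<Longrightarrow> unif_bv U N g \<Longrightarrow> unif_bv U N (\<lambda>n z. f n z - g n z)"
  using unif_bv_add[OF _ unif_bv_minus] by fastforce

text \<open>A bounded monotone sequence has bounded variation by telescoping.\<close>

lemma unif_bv_powr:
  assumes p: "p \<le> 0"
  shows "unif_bv U 1 (\<lambda>n z. of_real (real n powr p))"
  unfolding unif_bv_def
proof (intro exI conjI allI impI ballI)
  have "(\<lambda>n. real (Suc n) powr p) \<longlonglongrightarrow> (if p = 0 then 1 else 0)"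
  proof (cases "p = 0")
    case False
    then have "(\<lambda>n. real n powr p) \<longlonglongrightarrow> 0"
      using tendsto_neg_powr[OF _ filterlim_real_sequentially] p by simp
    from LIMSEQ_Suc[OF this] show ?thesis using False by simp
  qed simp
  from telescope_summable'[OF this]
  have "summable (\<lambda>n. real (Suc n) powr p - real (Suc (Suc n)) powr p)" .
  then show "summable (\<lambda>n. real n powr p - real (Suc n) powr p)"
    by (subst (asm) summable_Suc_iff)
  fix n :: nat assume n: "n \<ge> 1"
  have "real n powr p \<le> 1" using powr_mono[of p 0 "real n"] n p by simp
  then show "cmod (of_real (real n powr p)) \<le> 1" by simp
  have "real (Suc n) powr p \<le> real n powr p" using n p by (intro powr_mono2') auto
  moreover have "cmod (of_real (real (Suc n) powr p) - of_real (real n powr p)) = \<bar>real (Suc n) powr p - real n powr p\<bar>"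
    by (simp only: of_real_diff[symmetric] norm_of_real)
  ultimately show "cmod (of_real (real (Suc n) powr p) - of_real (real n powr p)) \<le> real n powr p - real (Suc n) powr p"
    by simp
qed

text \<open>Divide \<open>g (n + 1) - g n\<close> by the sum of the square roots, whose real part is bounded below.\<close>

lemma unif_bv_csqrt:
  assumes g: "unif_bv U N g" and c: "c > 0" "\<And>n z. n \<ge> N \<Longrightarrow> z \<in> U \<Longrightarrow> Re (csqrt (g n z)) \<ge> c"
  shows "unif_bv U N (\<lambda>n z. csqrt (g n z))"
proof -
  obtain K h where 1: "summable h" "\<And>n. n \<ge> N \<Longrightarrow> 0 \<le> h n" "K \<ge> 0"
    "\<And>n z. n \<ge> N \<Longrightarrow> z \<in> U \<Longrightarrow> cmod (g n z) \<le> K"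
    "\<And>n z. n \<ge> N \<Longrightarrow> z \<in> U \<Longrightarrow> cmod (g (Suc n) z - g n z) \<le> h n"
    using unif_bvE[OF g] by metis
  show ?thesis unfolding unif_bv_def
  proof (intro exI conjI allI impI ballI)
    show "summable (\<lambda>n. h n / (2 * c))" by (intro summable_divide 1)
    fix n z assume n: "n \<ge> N" "z \<in> U"
    have "(cmod (csqrt (g n z)))\<^sup>2 = cmod (g n z)" by (simp flip: norm_power)
    then show "cmod (csqrt (g n z)) \<le> sqrt K"
      using 1(4)[OF n] by (metis norm_ge_zero real_le_rsqrt real_sqrt_le_mono order_trans abs_of_nonneg)
    let ?s = "csqrt (g (Suc n) z) + csqrt (g n z)"
    have "Re ?s \<ge> 2 * c" using c(2)[OF n] c(2)[of "Suc n" z] n by simp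
    then have s: "cmod ?s \<ge> 2 * c" using complex_Re_le_cmod[of ?s] by linarith
    have "(csqrt (g (Suc n) z) - csqrt (g n z)) * ?s = g (Suc n) z - g n z"
      using power2_csqrt[of "g (Suc n) z"] power2_csqrt[of "g n z"]
      by (simp add: algebra_simps power2_eq_square)
    then have "cmod (csqrt (g (Suc n) z) - csqrt (g n z)) * cmod ?s = cmod (g (Suc n) z - g n z)"
      by (metis norm_mult)
    moreover have "cmod (csqrt (g (Suc n) z) - csqrt (g n z)) * (2 * c)
        \<le> cmod (csqrt (g (Suc n) z) - csqrt (g n z)) * cmod ?s"
      by (intro mult_left_mono s) auto
    ultimately show "cmod (csqrt (g (Suc n) z) - csqrt (g n z)) \<le> h n / (2 * c)"
      using 1(5)[OF n] c(1) by (simp add: field_simps)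
  qed
qed

lemma bigo_Suc:
  assumes "f \<in> O(\<lambda>n. 1 / (real n)\<^sup>2)"
  shows "(\<lambda>n. f (Suc n)) \<in> O(\<lambda>n. 1 / (real n)\<^sup>2)"
proof -
  have "(\<lambda>n. f (Suc n)) \<in> O(\<lambda>n. 1 / (real (Suc n))\<^sup>2)"
    by (rule landau_o.big.compose[OF assms filterlim_Suc])
  also have "(\<lambda>n. 1 / (real (Suc n))\<^sup>2) \<in> O(\<lambda>n. 1 / (real n)\<^sup>2)" by real_asymp
  finally show ?thesis .
qed

lemma summable_bigo_powr:
  assumes "f \<in> O(\<lambda>n. real n powr p)" "p < -1"
  shows "summable (\<lambda>n. \<bar>f n\<bar>)"
proof (rule summable_comparison_test_bigo)
  show "summable (\<lambda>n. norm (real n powr p))" using assms(2) by (simp add: summable_real_powr_iff)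
  show "(\<lambda>n. \<bar>f n\<bar>) \<in> O(\<lambda>n. real n powr p)" using assms(1) by simp
qed

section \<open>Approximate solution of the Riccati recursion\<close>

text \<open>Only \<open>\<gamma> = 1\<close> is treated here; the other sign follows by the reflection
\<open>(b, z, M) \<mapsto> (- b, - z, - M)\<close>.\<close>

locale jacobi_critical = jacobi a b for a b :: "nat \<Rightarrow> real" +
  fixes \<sigma> \<alpha> \<beta> \<tau> :: real
  assumes \<sigma>_pos: "0 < \<sigma>" and \<sigma>_le: "\<sigma> \<le> 3 / 2"
    and a_asym: "(\<lambda>n. a n / real n powr \<sigma> - (1 + \<alpha> / real n)) \<in> O(\<lambda>n. 1 / (real n)\<^sup>2)"
    and b_asym: "(\<lambda>n. b n / (2 * real n powr \<sigma>) - (1 + \<beta> / real n)) \<in> O(\<lambda>n. 1 / (real n)\<^sup>2)"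
    and \<tau>_def: "\<tau> = 2 * \<beta> - 2 * \<alpha> + \<sigma>"
    and \<tau>_neg: "\<sigma> > 1 \<Longrightarrow> \<tau> < 0"
begin

text \<open>Write \<open>f n = (-1)\<^sup>n * v n\<close>. The equation becomes a discrete Sturm-Liouville equation
\<open>a n * (v (n + 1) - v n) - a (n - 1) * (v n - v (n - 1)) = (b n - a n - a (n - 1) - z) * v n\<close>
whose potential has size \<open>n powr \<kappa>\<close>: it behaves like \<open>\<tau> * n powr (\<sigma> - 1)\<close> for \<open>\<sigma> > 1\<close>, like \<open>- z\<close> for \<open>\<sigma> < 1\<close> and like
\<open>\<tau> - z\<close> for \<open>\<sigma> = 1\<close>. The Riccati variable \<open>y n = a n * (v (n + 1) / v n - 1)\<close> then has size
\<open>s n = n powr \<rho>\<close>, and \<open>n powr (- \<eta>)\<close> is the size of the phase increment. The restriction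
\<open>\<sigma> \<le> 3 / 2\<close> is \<open>\<rho> \<le> 1\<close>, that is, the divergence of the series over \<open>1 / s n\<close>.\<close>

definition "\<kappa> = max (\<sigma> - 1) 0"
definition "\<eta> = (\<sigma> - \<kappa>) / 2"
definition "\<rho> = (\<sigma> + \<kappa>) / 2"

lemma exponents: "0 \<le> \<kappa>" "0 < \<eta>" "\<eta> \<le> 1 / 2" "0 < \<rho>" "\<rho> \<le> 1" "\<rho> = \<sigma> - \<eta>" "\<rho> = \<kappa> + \<eta>" "\<sigma> - 1 - \<kappa> \<le> 0"
  using \<sigma>_pos \<sigma>_le by (auto simp: \<kappa>_def \<eta>_def \<rho>_def field_simps max_def split: if_splits)

definition s :: "nat \<Rightarrow> real" where "s n = real n powr \<rho>"

text \<open>The Riccati variable obeys \<open>y (n + 1) = q n + y n / (1 + y n / a n)\<close>. In the rescaled variable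
\<open>x n = y n / s n\<close> a fixed point of this step satisfies, up to summable terms, the quadratic equation
\<open>x\<^sup>2 + Bcoef * x - Ccoef = 0\<close>, and \<open>X\<close> is its root in the upper half-plane. Rescaling first is the
essential point. The fixed points of the unscaled step drift by a relative amount of order \<open>1 / n\<close>,
which is not summable, whereas the roots \<open>X n z\<close> converge with bounded variation. The drift
\<open>s (n + 1) / s n - 1\<close>, asymptotically \<open>\<rho> / n\<close>, is the source of the first term of \<open>Bcoef\<close> and accounts for the amplitude of the
solution in a WKB ansatz.\<close>

definition Ccoef :: "nat \<Rightarrow> complex \<Rightarrow> complex" where
  "Ccoef n z = of_real (\<tau> * real n powr (\<sigma> - 1 - \<kappa>)) - z * of_real (real n powr (- \<kappa>))"

definition Bcoef :: "nat \<Rightarrow> complex \<Rightarrow> complex" where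
  "Bcoef n z = of_real (\<rho> * real n powr (\<eta> - 1)) - Ccoef n z * of_real (real n powr (- \<eta>))"

definition Disc :: "nat \<Rightarrow> complex \<Rightarrow> complex" where
  "Disc n z = - Ccoef n z - (Bcoef n z)\<^sup>2 / 4"

definition X :: "nat \<Rightarrow> complex \<Rightarrow> complex" where
  "X n z = - Bcoef n z / 2 + \<i> * csqrt (Disc n z)"

lemma X_root: "(X n z)\<^sup>2 + Bcoef n z * X n z - Ccoef n z = 0"
proof -
  have "(X n z)\<^sup>2 + Bcoef n z * X n z = - (csqrt (Disc n z))\<^sup>2 - (Bcoef n z)\<^sup>2 / 4"
    by (simp add: X_def power2_eq_square algebra_simps)
  then show ?thesis by (simp add: Disc_def)
qed

definition q :: "nat \<Rightarrow> complex \<Rightarrow> complex" where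
  "q n z = of_real (b (Suc n) - a (Suc n) - a n) - z"

definition Y :: "nat \<Rightarrow> complex \<Rightarrow> complex" where
  "Y n z = of_real (s n) * X n z"

definition resid :: "nat \<Rightarrow> complex \<Rightarrow> complex" where
  "resid n z = (Y (Suc n) z - q n z) * (1 + Y n z / of_real (a n)) - Y n z"

text \<open>The errors committed in passing from the exact step to the quadratic equation for \<open>X\<close>: in the
drift of the scale \<open>s\<close>, in the potential, in the quadratic coefficient, and in replacing \<open>a n\<close> by
\<open>n powr \<sigma>\<close>.\<close>

definition err_scale :: "nat \<Rightarrow> real" where "err_scale n = s (Suc n) - s n - \<rho> * s n / real n"
definition err_pot :: "nat \<Rightarrow> real" where "err_pot n = b (Suc n) - a (Suc n) - a n - \<tau> * real n powr (\<sigma> - 1)"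
definition err_quad :: "nat \<Rightarrow> real" where "err_quad n = s (Suc n) * s n / a n - real n powr \<kappa>"
definition err_a :: "nat \<Rightarrow> real" where "err_a n = real n powr \<kappa> * (1 / a n - 1 / real n powr \<sigma>)"

text \<open>Adding \<open>n powr \<kappa>\<close> times the quadratic equation for \<open>X n z\<close> cancels all terms that are not small.\<close>

lemma resid_eq:
  assumes n: "n \<ge> 1"
  shows "resid n z = of_real (s (Suc n)) * (X (Suc n) z - X n z) * (1 + of_real (s n / a n) * X n z)
     + of_real (err_scale n) * X n z - of_real (err_pot n) + of_real (err_quad n) * (X n z)\<^sup>2
     - (of_real (err_pot n * (s n / a n)) + Ccoef n z * of_real (s n * err_a n)) * X n z"
proof -
  let ?t = "complex_of_real (real n powr \<kappa>)" and ?C = "Ccoef n z" and ?X = "X n z"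
  have pos: "real n > 0" using n by simp
  have q: "q n z = ?t * ?C + of_real (err_pot n)"
  proof -
    have "real n powr \<kappa> * real n powr (\<sigma> - 1 - \<kappa>) = real n powr (\<sigma> - 1)"
      by (simp flip: powr_add)
    moreover have "real n powr \<kappa> * real n powr (- \<kappa>) = 1" using pos by (simp flip: powr_add)
    moreover have "?t * ?C = of_real (\<tau> * (real n powr \<kappa> * real n powr (\<sigma> - 1 - \<kappa>)))
        - z * of_real (real n powr \<kappa> * real n powr (- \<kappa>))"
      by (simp add: Ccoef_def algebra_simps)
    ultimately have "?t * ?C = of_real (\<tau> * real n powr (\<sigma> - 1)) - z" by simp
    then show ?thesis by (simp add: q_def err_pot_def)
  qed
  have B: "?t * Bcoef n z = of_real (\<rho> * s n / real n) - ?C * of_real (s n * (real n powr \<kappa> / real n powr \<sigma>))"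
  proof -
    have 1: "real n powr \<kappa> * real n powr (\<eta> - 1) = s n / real n"
      using exponents pos by (simp add: s_def powr_diff flip: powr_add)
    have 2: "real n powr \<kappa> * real n powr (- \<eta>) = s n * (real n powr \<kappa> / real n powr \<sigma>)"
    proof -
      have "s n * (real n powr \<kappa> / real n powr \<sigma>) = real n powr (\<rho> + (\<kappa> - \<sigma>))"
        by (simp add: s_def powr_add powr_diff)
      also have "\<rho> + (\<kappa> - \<sigma>) = \<kappa> + - \<eta>" using exponents by simp
      also have "real n powr (\<kappa> + - \<eta>) = real n powr \<kappa> * real n powr (- \<eta>)" by (rule powr_add)
      finally show ?thesis by simp
    qed
    have "?t * Bcoef n z = of_real (\<rho> * (real n powr \<kappa> * real n powr (\<eta> - 1)))
       - ?C * of_real (real n powr \<kappa> * real n powr (- \<eta>))"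
      by (simp add: Bcoef_def algebra_simps)
    then show ?thesis unfolding 1 2 by simp
  qed
  have err_a: "s n * err_a n = real n powr \<kappa> * (s n / a n) - s n * (real n powr \<kappa> / real n powr \<sigma>)"
    by (simp add: err_a_def algebra_simps)
  have err_quad: "err_quad n = s (Suc n) * (s n / a n) - real n powr \<kappa>" by (simp add: err_quad_def)
  have root: "?t * ?X\<^sup>2 + ?t * Bcoef n z * ?X - ?t * ?C = 0"
    using X_root[of n z] by (metis (no_types, lifting) mult.assoc mult_zero_right right_diff_distrib distrib_left)
  have sa: "Y n z / of_real (a n) = of_real (s n / a n) * ?X" by (simp add: Y_def)
  define r where "r = complex_of_real (s n / a n)"
  define u where "u = complex_of_real (\<rho> * s n / real n)"
  define v where "v = complex_of_real (s n * (real n powr \<kappa> / real n powr \<sigma>))"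
  have root': "?t * ?X\<^sup>2 + (u - ?C * v) * ?X - ?t * ?C = 0" using root unfolding B u_def v_def .
  have err_a': "complex_of_real (s n * err_a n) = ?t * r - v" unfolding err_a r_def v_def by simp
  have err_quad': "complex_of_real (err_quad n) = of_real (s (Suc n)) * r - ?t" unfolding err_quad r_def by simp
  have err_scale': "complex_of_real (err_scale n) = of_real (s (Suc n)) - of_real (s n) - u" unfolding err_scale_def u_def by simp
  have err_pot': "complex_of_real (err_pot n * (s n / a n)) = of_real (err_pot n) * r" unfolding r_def by simp
  show ?thesis
    unfolding resid_def sa q unfolding Y_def err_a' err_quad' err_scale' err_pot' unfolding r_def[symmetric]
    using root' by algebra
qed

lemma ratio_Suc: "n \<ge> 1 \<Longrightarrow> real (Suc n) powr p / real n powr p = (1 + 1 / real n) powr p"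
  by (subst powr_divide[symmetric]) (auto simp: field_simps)

lemma a_ratio: "(\<lambda>n. a n / real n powr \<sigma> - 1) \<in> O(\<lambda>n. 1 / real n)"
proof -
  have "(\<lambda>n::nat. 1 / (real n)\<^sup>2) \<in> O(\<lambda>n. 1 / real n)" by real_asymp
  with a_asym have "(\<lambda>n. a n / real n powr \<sigma> - (1 + \<alpha> / real n)) \<in> O(\<lambda>n. 1 / real n)"
    using landau_o.big.trans by blast
  moreover have "(\<lambda>n::nat. \<alpha> / real n) \<in> O(\<lambda>n. 1 / real n)" by real_asymp
  ultimately have "(\<lambda>n. a n / real n powr \<sigma> - (1 + \<alpha> / real n) + \<alpha> / real n) \<in> O(\<lambda>n. 1 / real n)"
    by (rule sum_in_bigo)
  then show ?thesis by simp
qed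

lemma a_ratio_lim: "(\<lambda>n. a n / real n powr \<sigma>) \<longlonglongrightarrow> 1"
proof -
  have "(\<lambda>n. a n / real n powr \<sigma> - 1) \<in> o(\<lambda>n. 1)"
    by (rule landau_o.big_small_trans[OF a_ratio]) real_asymp
  then have "(\<lambda>n. a n / real n powr \<sigma> - 1) \<longlonglongrightarrow> 0" by (rule smalloD_tendsto[where g="\<lambda>_. 1", simplified])
  then show ?thesis by (simp add: LIM_zero_iff)
qed

lemma inv_ratio_lim: "(\<lambda>n. real n powr \<sigma> / a n) \<longlonglongrightarrow> 1"
  using tendsto_inverse[OF a_ratio_lim] by (simp add: inverse_eq_divide)

lemma inv_ratio: "(\<lambda>n. real n powr \<sigma> / a n - 1) \<in> O(\<lambda>n. 1 / real n)"
proof -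
  have "(\<lambda>n. real n powr \<sigma> / a n) \<in> O(\<lambda>_. 1)"
    by (rule bigoI_tendsto[OF _ ]) (use inv_ratio_lim in auto)
  from landau_o.big.mult[OF this a_ratio]
  have "(\<lambda>n. real n powr \<sigma> / a n * (a n / real n powr \<sigma> - 1)) \<in> O(\<lambda>n. 1 / real n)" by simp
  then have "(\<lambda>n. - (real n powr \<sigma> / a n * (a n / real n powr \<sigma> - 1))) \<in> O(\<lambda>n. 1 / real n)"
    by (simp only: landau_o.big.uminus_in_iff)
  moreover have "eventually (\<lambda>n. - (real n powr \<sigma> / a n * (a n / real n powr \<sigma> - 1)) = real n powr \<sigma> / a n - 1) sequentially"
    using eventually_gt_at_top[of 0]
  proof eventually_elim
    case (elim n)
    then show ?case using a_nz[of n] by (simp add: field_simps)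
  qed
  ultimately show ?thesis by (subst (asm) landau_o.big.in_cong)
qed

lemma err_scale_summable: "summable (\<lambda>n. \<bar>err_scale n / s n\<bar>)"
proof (rule summable_bigo_powr)
  have "(\<lambda>n::nat. (1 + 1 / real n) powr \<rho> - 1 - \<rho> / real n) \<in> O(\<lambda>n. real n powr (-2))" by real_asymp
  moreover have "eventually (\<lambda>n. (1 + 1 / real n) powr \<rho> - 1 - \<rho> / real n = err_scale n / s n) sequentially"
    using eventually_ge_at_top[of 1]
  proof eventually_elim
    case (elim n)
    have "err_scale n / s n = s (Suc n) / s n - 1 - \<rho> / real n"
      using elim by (simp add: err_scale_def s_def field_simps)
    then show ?case using elim by (simp add: s_def ratio_Suc del: of_nat_Suc)
  qed
  ultimately show "(\<lambda>n. err_scale n / s n) \<in> O(\<lambda>n. real n powr (-2))" by (subst (asm) landau_o.big.in_cong)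
qed simp

text \<open>The coefficients of \<open>1 / n\<close> cancel by the choice of \<open>\<tau>\<close>.\<close>

lemma err_pot_bigo: "(\<lambda>n. err_pot n / real n powr \<sigma>) \<in> O(\<lambda>n. 1 / (real n)\<^sup>2)"
proof -
  let ?O = "O(\<lambda>n::nat. 1 / (real n)\<^sup>2)"
  define g where "g n = (1 + 1 / real n) powr \<sigma>" for n :: nat
  define ea where "ea n = a n / real n powr \<sigma> - (1 + \<alpha> / real n)" for n
  define eb where "eb n = b n / (2 * real n powr \<sigma>) - (1 + \<beta> / real n)" for n
  have main: "(\<lambda>n. 2 * g n * (1 + \<beta> / real (Suc n)) - g n * (1 + \<alpha> / real (Suc n)) - (1 + \<alpha> / real n) - \<tau> / real n) \<in> ?O"
    unfolding g_def \<tau>_def by real_asymp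
  have g1: "g \<in> O(\<lambda>_. 1)" unfolding g_def by real_asymp
  have ea: "ea \<in> ?O" and eb: "eb \<in> ?O" unfolding ea_def eb_def using a_asym b_asym by simp_all
  have gb: "(\<lambda>n. 2 * (g n * eb (Suc n))) \<in> ?O"
    using landau_o.big.mult[OF g1 bigo_Suc[OF eb]] by simp
  have ga: "(\<lambda>n. g n * ea (Suc n)) \<in> ?O"
    using landau_o.big.mult[OF g1 bigo_Suc[OF ea]] by simp
  have "(\<lambda>n. 2 * g n * (1 + \<beta> / real (Suc n)) - g n * (1 + \<alpha> / real (Suc n)) - (1 + \<alpha> / real n) - \<tau> / real n
     + 2 * (g n * eb (Suc n)) - g n * ea (Suc n) - ea n) \<in> ?O"
    by (intro sum_in_bigo main gb ga ea)
  moreover have "eventually (\<lambda>n. 2 * g n * (1 + \<beta> / real (Suc n)) - g n * (1 + \<alpha> / real (Suc n)) - (1 + \<alpha> / real n) - \<tau> / real n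
     + 2 * (g n * eb (Suc n)) - g n * ea (Suc n) - ea n = err_pot n / real n powr \<sigma>) sequentially"
    using eventually_ge_at_top[of 1]
  proof eventually_elim
    case (elim n)
    have g: "g n = real (Suc n) powr \<sigma> / real n powr \<sigma>" using elim by (simp add: g_def ratio_Suc del: of_nat_Suc)
    have nz: "real n powr \<sigma> \<noteq> 0" "real (Suc n) powr \<sigma> \<noteq> 0" using elim by auto
    have b1: "2 * g n * (1 + \<beta> / real (Suc n) + eb (Suc n)) = b (Suc n) / real n powr \<sigma>"
      unfolding eb_def g using nz by simp
    have a1: "g n * (1 + \<alpha> / real (Suc n) + ea (Suc n)) = a (Suc n) / real n powr \<sigma>"
      unfolding ea_def g using nz by simp
    have a0: "1 + \<alpha> / real n + ea n = a n / real n powr \<sigma>" by (simp add: ea_def)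
    have t: "\<tau> * real n powr (\<sigma> - 1) / real n powr \<sigma> = \<tau> / real n"
      using elim by (simp add: powr_diff)
    have "err_pot n / real n powr \<sigma> = b (Suc n) / real n powr \<sigma> - a (Suc n) / real n powr \<sigma> - a n / real n powr \<sigma>
        - \<tau> * real n powr (\<sigma> - 1) / real n powr \<sigma>"
      by (simp add: err_pot_def diff_divide_distrib)
    then show ?case unfolding t a0[symmetric] a1[symmetric] b1[symmetric] by (simp add: algebra_simps)
  qed
  ultimately show ?thesis by (subst (asm) landau_o.big.in_cong)
qed

lemma err_pot_summable: "summable (\<lambda>n. \<bar>err_pot n / s n\<bar>)"
proof (rule summable_bigo_powr)
  have "(\<lambda>n. err_pot n / real n powr \<sigma> * real n powr \<eta>) \<in> O(\<lambda>n. 1 / (real n)\<^sup>2 * real n powr \<eta>)"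
    by (intro landau_o.big.mult err_pot_bigo) auto
  also have "(\<lambda>n::nat. 1 / (real n)\<^sup>2 * real n powr \<eta>) \<in> O(\<lambda>n. real n powr (\<eta> - 2))" by real_asymp
  finally have "(\<lambda>n. err_pot n / real n powr \<sigma> * real n powr \<eta>) \<in> O(\<lambda>n. real n powr (\<eta> - 2))" .
  moreover have "err_pot n / real n powr \<sigma> * real n powr \<eta> = err_pot n / s n" for n
    unfolding s_def exponents(6) powr_diff by simp
  ultimately show "(\<lambda>n. err_pot n / s n) \<in> O(\<lambda>n. real n powr (\<eta> - 2))" by simp
  show "\<eta> - 2 < -1" using exponents by simp
qed

lemma err_quad_summable: "summable (\<lambda>n. \<bar>err_quad n / s n\<bar>)"
proof (rule summable_bigo_powr)
  let ?g = "\<lambda>n::nat. (1 + 1 / real n) powr \<rho>" and ?r = "\<lambda>n. real n powr \<sigma> / a n"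
  have g: "?g \<in> O(\<lambda>_. 1)" "(\<lambda>n. ?g n - 1) \<in> O(\<lambda>n. 1 / real n)" by real_asymp+
  have "(\<lambda>n. ?g n * (?r n - 1)) \<in> O(\<lambda>n. 1 / real n)"
    using landau_o.big.mult[OF g(1) inv_ratio] by simp
  from sum_in_bigo(1)[OF this g(2)] have "(\<lambda>n. ?g n * ?r n - 1) \<in> O(\<lambda>n. 1 / real n)"
    by (simp add: algebra_simps)
  then have "(\<lambda>n. real n powr (- \<eta>) * (?g n * ?r n - 1)) \<in> O(\<lambda>n. real n powr (- \<eta>) * (1 / real n))"
    by (intro landau_o.big.mult) auto
  also have "(\<lambda>n::nat. real n powr (- \<eta>) * (1 / real n)) \<in> O(\<lambda>n. real n powr (- \<eta> - 1))" by real_asymp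
  finally have "(\<lambda>n. real n powr (- \<eta>) * (?g n * ?r n - 1)) \<in> O(\<lambda>n. real n powr (- \<eta> - 1))" .
  moreover have "eventually (\<lambda>n. real n powr (- \<eta>) * (?g n * ?r n - 1) = err_quad n / s n) sequentially"
    using eventually_ge_at_top[of 1]
  proof eventually_elim
    case (elim n)
    have g: "?g n = s (Suc n) / s n" using elim by (simp add: s_def ratio_Suc del: of_nat_Suc)
    have sp: "s n > 0" using elim by (simp add: s_def)
    have 1: "real n powr (- \<eta>) * real n powr \<sigma> = s n"
      by (simp add: s_def exponents(6) flip: powr_add)
    have 2: "real n powr \<kappa> = real n powr (- \<eta>) * s n"
      by (simp add: s_def exponents(7) flip: powr_add)
    have "real n powr (- \<eta>) * (?g n * ?r n - 1) = (real n powr (- \<eta>) * real n powr \<sigma>) * ?g n / a n - real n powr (- \<eta>)"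
      by (simp add: algebra_simps)
    also have "\<dots> = err_quad n / s n" unfolding 1 g err_quad_def 2 using sp by (simp add: diff_divide_distrib)
    finally show ?case .
  qed
  ultimately show "(\<lambda>n. err_quad n / s n) \<in> O(\<lambda>n. real n powr (- \<eta> - 1))" by (subst (asm) landau_o.big.in_cong)
  show "- \<eta> - 1 < -1" using exponents by simp
qed

lemma err_a_summable: "summable (\<lambda>n. \<bar>err_a n\<bar>)"
proof (rule summable_bigo_powr)
  have "(\<lambda>n. real n powr (\<kappa> - \<sigma>) * (real n powr \<sigma> / a n - 1)) \<in> O(\<lambda>n. real n powr (\<kappa> - \<sigma>) * (1 / real n))"
    by (intro landau_o.big.mult inv_ratio) auto
  also have "(\<lambda>n::nat. real n powr (\<kappa> - \<sigma>) * (1 / real n)) \<in> O(\<lambda>n. real n powr (\<kappa> - \<sigma> - 1))" by real_asymp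
  finally have "(\<lambda>n. real n powr (\<kappa> - \<sigma>) * (real n powr \<sigma> / a n - 1)) \<in> O(\<lambda>n. real n powr (\<kappa> - \<sigma> - 1))" .
  moreover have "eventually (\<lambda>n. real n powr (\<kappa> - \<sigma>) * (real n powr \<sigma> / a n - 1) = err_a n) sequentially"
    using eventually_ge_at_top[of 1]
    by eventually_elim (simp add: err_a_def powr_diff field_simps)
  ultimately show "(\<lambda>n. err_a n) \<in> O(\<lambda>n. real n powr (\<kappa> - \<sigma> - 1))" by (subst (asm) landau_o.big.in_cong)
  show "\<kappa> - \<sigma> - 1 < -1" using exponents by simp
qed

lemma s_pos: "n \<ge> 1 \<Longrightarrow> s n > 0" by (simp add: s_def)

lemma s_mono: "s n \<le> s (Suc n)"
  unfolding s_def using exponents by (intro powr_mono2) auto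

lemma s_Suc_le: "n \<ge> 1 \<Longrightarrow> s (Suc n) \<le> 2 * s n"
proof -
  assume n: "n \<ge> 1"
  have "(1 + 1 / real n) powr \<rho> \<le> (1 + 1 / real n) powr 1"
    using exponents by (intro powr_mono) auto
  also have "\<dots> \<le> 2" using n by simp
  finally have "s (Suc n) / s n \<le> 2" using n by (simp add: s_def ratio_Suc del: of_nat_Suc)
  then show ?thesis using s_pos[OF n] by (simp add: field_simps)
qed

lemma s_over_a: obtains K where "K > 0" "\<And>n. n \<ge> 1 \<Longrightarrow> s n / a n \<le> K"
proof -
  have "convergent (\<lambda>n. real n powr \<sigma> / a n)" using inv_ratio_lim by (auto simp: convergent_def)
  then have "Bseq (\<lambda>n. real n powr \<sigma> / a n)" by (rule convergent_imp_Bseq)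
  then obtain K where K: "K > 0" "\<And>n. norm (real n powr \<sigma> / a n) \<le> K" unfolding Bseq_def by blast
  have "s n / a n \<le> K" if "n \<ge> 1" for n
  proof -
    have "s n \<le> real n powr \<sigma>" unfolding s_def using that exponents by (intro powr_mono) auto
    then have "s n / a n \<le> real n powr \<sigma> / a n" using a_pos[of n] by (intro divide_right_mono) auto
    also have "\<dots> \<le> K" using K(2)[of n] a_pos[of n] by (simp add: abs_of_pos)
    finally show ?thesis .
  qed
  with K(1) show ?thesis by (rule that)
qed

text \<open>The limit of \<open>- Ccoef n z\<close>. Solutions oscillate at infinity exactly when it is positive, which
for real \<open>z\<close> is the condition that \<open>z\<close> lies on the cut. More generally, the condition
\<open>Llim z \<notin> \<real>\<^sub>\<le>\<^sub>0\<close> used below describes an open set that contains the cut and the two open half-planes.\<close>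

definition Llim :: "complex \<Rightarrow> complex" where
  "Llim z = (if \<sigma> > 1 then - of_real \<tau> else if \<sigma> < 1 then z else z - of_real \<tau>)"

text \<open>Joint limits in \<open>(n, z)\<close> give bounds that are uniform near \<open>z0\<close>.\<close>

lemma coeff_limits:
  fixes z0 :: complex
  defines "F \<equiv> sequentially \<times>\<^sub>F nhds z0"
  shows "((\<lambda>x. Ccoef (fst x) (snd x)) \<longlongrightarrow> - Llim z0) F"
    and "((\<lambda>x. Bcoef (fst x) (snd x)) \<longlongrightarrow> 0) F"
    and "((\<lambda>x. Disc (fst x) (snd x)) \<longlongrightarrow> Llim z0) F"
proof -
  have z: "(snd \<longlongrightarrow> z0) F" unfolding F_def using filterlim_snd .
  have pw: "((\<lambda>x. complex_of_real (real (fst x) powr p)) \<longlongrightarrow> (if p = 0 then 1 else 0)) F" if "p \<le> 0" for p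
  proof -
    have "(\<lambda>n::nat. real n powr p) \<longlonglongrightarrow> (if p = 0 then 1 else 0)"
    proof (cases "p = 0")
      case True
      have "eventually (\<lambda>n::nat. real n powr p = 1) sequentially"
        using eventually_gt_at_top[of 0] by eventually_elim (simp add: True)
      from tendsto_eventually[OF this] show ?thesis by (simp only: if_P[OF True])
    next
      case False
      then show ?thesis using tendsto_neg_powr[OF _ filterlim_real_sequentially, of p] that by simp
    qed
    then have "(\<lambda>n::nat. complex_of_real (real n powr p)) \<longlonglongrightarrow> of_real (if p = 0 then 1 else 0)"
      by (rule tendsto_of_real)
    moreover have "filterlim fst sequentially F" unfolding F_def by (rule filterlim_fst)
    ultimately have "((\<lambda>x. complex_of_real (real (fst x) powr p)) \<longlongrightarrow> of_real (if p = 0 then 1 else 0)) F"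
      by (rule filterlim_compose)
    moreover have "complex_of_real (if p = 0 then 1 else 0) = (if p = 0 then 1 else 0)" by simp
    ultimately show ?thesis by (simp only:)
  qed
  have C: "((\<lambda>x. Ccoef (fst x) (snd x)) \<longlongrightarrow>
      of_real \<tau> * (if \<sigma> - 1 - \<kappa> = 0 then 1 else 0) - z0 * (if - \<kappa> = 0 then 1 else 0)) F"
    unfolding Ccoef_def of_real_mult
    by (intro tendsto_intros pw z) (use exponents in auto)
  also have "of_real \<tau> * (if \<sigma> - 1 - \<kappa> = 0 then 1 else 0) - z0 * (if - \<kappa> = 0 then 1 else 0) = - Llim z0"
    by (auto simp: \<kappa>_def Llim_def max_def)
  finally show C': "((\<lambda>x. Ccoef (fst x) (snd x)) \<longlongrightarrow> - Llim z0) F" .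
  have "((\<lambda>x. Bcoef (fst x) (snd x)) \<longlongrightarrow> of_real \<rho> * (if \<eta> - 1 = 0 then 1 else 0) - (- Llim z0) * (if - \<eta> = 0 then 1 else 0)) F"
    unfolding Bcoef_def of_real_mult
    by (intro tendsto_intros pw C') (use exponents in auto)
  then show B: "((\<lambda>x. Bcoef (fst x) (snd x)) \<longlongrightarrow> 0) F" using exponents by simp
  have "((\<lambda>x. Disc (fst x) (snd x)) \<longlongrightarrow> - (- Llim z0) - 0\<^sup>2 / 4) F"
    unfolding Disc_def by (intro tendsto_intros C' B) auto
  then show "((\<lambda>x. Disc (fst x) (snd x)) \<longlongrightarrow> Llim z0) F" by simp
qed

lemma local_bounds:
  assumes L: "Llim z0 \<notin> \<real>\<^sub>\<le>\<^sub>0"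
  obtains r N c K where "r > 0" "N \<ge> 1" "c > 0" "K > 0"
    "\<And>n z. n \<ge> N \<Longrightarrow> z \<in> cball z0 r \<Longrightarrow> Im (X n z) \<ge> c \<and> Re (csqrt (Disc n z)) \<ge> c \<and>
        cmod (X n z) \<le> K \<and> cmod (Ccoef n z) \<le> K"
proof -
  let ?F = "sequentially \<times>\<^sub>F nhds z0"
  define R where "R = Re (csqrt (Llim z0))"
  \<comment> \<open>\<open>Re (csqrt w)\<close> vanishes only for nonpositive \<open>w\<close>\<close>
  have R: "R > 0"
  proof -
    have "R \<ge> 0" unfolding R_def using csqrt_principal[of "Llim z0"] by (metis less_imp_le order_refl)
    moreover have "R \<noteq> 0"
    proof
      assume "R = 0"
      then have "csqrt (Llim z0) = \<i> * of_real (Im (csqrt (Llim z0)))"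
        by (simp add: complex_eq_iff R_def)
      then have "Llim z0 = (\<i> * of_real (Im (csqrt (Llim z0))))\<^sup>2" by (metis power2_csqrt)
      also have "\<dots> = of_real (- (Im (csqrt (Llim z0)))\<^sup>2)" by (simp add: power_mult_distrib)
      finally have "Llim z0 \<in> \<real>\<^sub>\<le>\<^sub>0" by (metis nonpos_Reals_of_real_iff neg_le_0_iff_le zero_le_power2)
      with L show False by simp
    qed
    ultimately show ?thesis by simp
  qed
  have sq: "((\<lambda>x. csqrt (Disc (fst x) (snd x))) \<longlongrightarrow> csqrt (Llim z0)) ?F"
    by (rule isCont_tendsto_compose[OF continuous_at_csqrt[OF L] coeff_limits(3)])
  have X: "((\<lambda>x. X (fst x) (snd x)) \<longlongrightarrow> - 0 / 2 + \<i> * csqrt (Llim z0)) ?F"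
    unfolding X_def by (intro tendsto_intros sq coeff_limits) auto
  define K where "K = cmod (csqrt (Llim z0)) + cmod (Llim z0) + 1"
  have "eventually (\<lambda>x. Im (X (fst x) (snd x)) > R / 2) ?F"
    using tendsto_Im[OF X] R by (intro order_tendstoD(1)[where y=R]) (auto simp: R_def)
  moreover have "eventually (\<lambda>x. Re (csqrt (Disc (fst x) (snd x))) > R / 2) ?F"
    using tendsto_Re[OF sq] R by (intro order_tendstoD(1)[where y=R]) (auto simp: R_def)
  moreover have "eventually (\<lambda>x. cmod (X (fst x) (snd x)) < K) ?F"
    using tendsto_norm[OF X] unfolding K_def
    by (rule order_tendstoD(2)) (simp add: norm_mult add_nonneg_pos)
  moreover have "eventually (\<lambda>x. cmod (Ccoef (fst x) (snd x)) < K) ?F"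
    using tendsto_norm[OF coeff_limits(1)[of z0]] unfolding K_def
    by (rule order_tendstoD(2)) (simp add: add_nonneg_pos)
  ultimately have "eventually (\<lambda>x. Im (X (fst x) (snd x)) > R / 2 \<and> Re (csqrt (Disc (fst x) (snd x))) > R / 2
      \<and> cmod (X (fst x) (snd x)) < K \<and> cmod (Ccoef (fst x) (snd x)) < K) ?F"
    by eventually_elim auto
  then obtain Pf Pg where Pf: "eventually Pf sequentially" and Pg: "eventually Pg (nhds z0)"
    and P: "\<And>n z. Pf n \<Longrightarrow> Pg z \<Longrightarrow> Im (X n z) > R / 2 \<and> Re (csqrt (Disc n z)) > R / 2
      \<and> cmod (X n z) < K \<and> cmod (Ccoef n z) < K"
    unfolding eventually_prod_filter by auto
  obtain N where N: "\<And>n. n \<ge> N \<Longrightarrow> Pf n" using Pf by (auto simp: eventually_sequentially)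
  obtain d where d: "d > 0" "\<And>z. dist z z0 < d \<Longrightarrow> Pg z" using Pg by (auto simp: eventually_nhds_metric)
  show ?thesis
  proof (rule that[of "d / 2" "max N 1" "R / 2" K])
    show "K > 0" unfolding K_def by (simp add: add_nonneg_pos)
    fix n z assume n: "n \<ge> max N 1" "z \<in> cball z0 (d / 2)"
    then have "Pf n" "Pg z" using N d by (auto simp: dist_commute)
    from P[OF this] show "Im (X n z) \<ge> R / 2 \<and> Re (csqrt (Disc n z)) \<ge> R / 2 \<and>
        cmod (X n z) \<le> K \<and> cmod (Ccoef n z) \<le> K" by auto
  qed (use d R in auto)
qed

lemma unif_bv_coeffs:
  assumes "bounded U"
  shows "unif_bv U 1 Ccoef" "unif_bv U 1 Bcoef" "unif_bv U 1 Disc"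
proof -
  obtain Z where Z: "\<And>z. z \<in> U \<Longrightarrow> cmod z \<le> Z" using assms unfolding bounded_iff by blast
  have cst: "unif_bv U 1 (\<lambda>n z. of_real c)" for c by (rule unif_bv_const[where K="\<bar>c\<bar>"]) simp
  have idz: "unif_bv U 1 (\<lambda>n z. z)" by (rule unif_bv_const[OF Z])
  show C: "unif_bv U 1 Ccoef"
    unfolding Ccoef_def[abs_def] of_real_mult
    by (intro unif_bv_diff unif_bv_mult cst idz unif_bv_powr) (use exponents in auto)
  show B: "unif_bv U 1 Bcoef"
    unfolding Bcoef_def[abs_def] of_real_mult
    by (intro unif_bv_diff unif_bv_mult cst C unif_bv_powr) (use exponents in auto)
  have "unif_bv U 1 (\<lambda>n z. - Ccoef n z - of_real (1/4) * (Bcoef n z * Bcoef n z))"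
    by (intro unif_bv_diff unif_bv_mult unif_bv_minus cst C B)
  then show "unif_bv U 1 Disc" by (simp add: Disc_def[abs_def] power2_eq_square)
qed

text \<open>Locally uniformly in \<open>z\<close>, the points \<open>Y n z\<close> satisfy the Riccati recursion up to summable
hyperbolic errors. The contribution of \<open>X (n + 1) - X n\<close> is summable by bounded variation, the others by the
asymptotics of the coefficients.\<close>

lemma local_residual:
  assumes L: "Llim z0 \<notin> \<real>\<^sub>\<le>\<^sub>0"
  obtains r N K e where "r > 0" "N \<ge> 1" "K > 0" "summable e"
    "\<And>n z. n \<ge> N \<Longrightarrow> z \<in> cball z0 r \<Longrightarrow> Im (Y n z) > 0 \<and> Im (Y n z) \<le> K * s n
       \<and> cmod (resid n z) \<le> e n * sqrt (Im (Y n z) * Im (Y (Suc n) z)) \<and> 0 \<le> e n"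
    "\<And>n. n \<ge> N \<Longrightarrow> continuous_on (cball z0 r) (Y n)"
proof -
  obtain r N c K where r: "r > 0" "N \<ge> 1" "c > 0" "K > 0" and
    bd: "\<And>n z. n \<ge> N \<Longrightarrow> z \<in> cball z0 r \<Longrightarrow> Im (X n z) \<ge> c \<and> Re (csqrt (Disc n z)) \<ge> c \<and>
        cmod (X n z) \<le> K \<and> cmod (Ccoef n z) \<le> K"
    using local_bounds[OF L] by metis
  let ?U = "cball z0 r"
  have bv: "unif_bv ?U N Bcoef" "unif_bv ?U N Disc"
    using unif_bv_mono[OF unif_bv_coeffs(2)] unif_bv_mono[OF unif_bv_coeffs(3)] r by auto
  have "unif_bv ?U N (\<lambda>n z. of_real (-1/2) * Bcoef n z + \<i> * csqrt (Disc n z))"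
    by (intro unif_bv_add unif_bv_mult bv unif_bv_csqrt[OF bv(2) r(3)] unif_bv_const[of _ "\<lambda>_. of_real (-1/2)" 1] unif_bv_const[of _ "\<lambda>_. \<i>" 1])
       (use bd in auto)
  then have "unif_bv ?U N X" by (simp add: X_def[abs_def])
  then obtain K' h where h: "summable h" "\<And>n. n \<ge> N \<Longrightarrow> 0 \<le> h n"
    "\<And>n z. n \<ge> N \<Longrightarrow> z \<in> ?U \<Longrightarrow> cmod (X (Suc n) z - X n z) \<le> h n"
    by (elim unif_bvE) metis
  obtain A where A: "A > 0" "\<And>n. n \<ge> 1 \<Longrightarrow> s n / a n \<le> A" using s_over_a by metis
  \<comment> \<open>the factor \<open>2\<close> comes from \<open>s (n + 1) \<le> 2 * s n\<close>\<close>
  define g where "g n = (1 + A * K) * 2 * h n + \<bar>err_scale n / s n\<bar> * K + \<bar>err_pot n / s n\<bar> + \<bar>err_quad n / s n\<bar> * K\<^sup>2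
      + (\<bar>err_pot n / s n\<bar> * A + K * \<bar>err_a n\<bar>) * K" for n
  have sumg: "summable g"
    unfolding g_def[abs_def]
    by (intro summable_add summable_mult summable_mult2 h(1) err_scale_summable err_pot_summable err_quad_summable err_a_summable)
  have res: "cmod (resid n z) \<le> g n * s n" if n: "n \<ge> N" and z: "z \<in> ?U" for n z
  proof -
    have n1: "n \<ge> 1" using n r by simp
    have sp: "s n > 0" by (rule s_pos[OF n1])
    have x: "cmod (X n z) \<le> K" and cc: "cmod (Ccoef n z) \<le> K" using bd[OF n z] by auto
    have sa: "0 \<le> s n / a n" "s n / a n \<le> A" using A(2)[OF n1] sp a_pos[of n] by auto
    have abs_s: "\<bar>E\<bar> = \<bar>E / s n\<bar> * s n" for E using sp by (simp add: abs_divide)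
    let ?T1 = "of_real (s (Suc n)) * (X (Suc n) z - X n z) * (1 + of_real (s n / a n) * X n z)"
    let ?T2 = "of_real (err_scale n) * X n z" and ?T3 = "complex_of_real (err_pot n)" and ?T4 = "of_real (err_quad n) * (X n z)\<^sup>2"
    let ?T5 = "(of_real (err_pot n * (s n / a n)) + Ccoef n z * of_real (s n * err_a n)) * X n z"
    have "cmod (1 + of_real (s n / a n) * X n z) \<le> 1 + A * K"
    proof -
      have "cmod (1 + of_real (s n / a n) * X n z) \<le> 1 + (s n / a n) * cmod (X n z)"
        using norm_triangle_ineq[of 1 "of_real (s n / a n) * X n z"]
        by (simp only: norm_mult norm_of_real abs_of_nonneg[OF sa(1)] norm_one)
      also have "\<dots> \<le> 1 + A * K" using sa x A(1) by (intro add_mono mult_mono) auto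
      finally show ?thesis .
    qed
    then have "cmod ?T1 \<le> (2 * s n) * h n * (1 + A * K)"
      unfolding norm_mult using s_Suc_le[OF n1] h(3)[OF n z] h(2)[OF n] sp s_pos[of "Suc n"] r A
      by (intro mult_mono) auto
    also have "(2 * s n) * h n * (1 + A * K) = (1 + A * K) * 2 * h n * s n" by (simp add: algebra_simps)
    finally have 1: "cmod ?T1 \<le> (1 + A * K) * 2 * h n * s n" .
    have 2: "cmod ?T2 \<le> \<bar>err_scale n / s n\<bar> * K * s n"
    proof -
      have "cmod ?T2 \<le> \<bar>err_scale n\<bar> * K" unfolding norm_mult norm_of_real by (intro mult_left_mono x) auto
      then show ?thesis by (subst (asm) abs_s) (simp add: mult_ac)
    qed
    have 3: "cmod ?T3 \<le> \<bar>err_pot n / s n\<bar> * s n" using abs_s[of "err_pot n"] by simp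
    have 4: "cmod ?T4 \<le> \<bar>err_quad n / s n\<bar> * K\<^sup>2 * s n"
    proof -
      have "cmod ?T4 \<le> \<bar>err_quad n\<bar> * K\<^sup>2" unfolding norm_mult norm_of_real norm_power
        by (intro mult_left_mono power_mono x) auto
      then show ?thesis by (subst (asm) abs_s) (simp add: mult_ac)
    qed
    have 5: "cmod ?T5 \<le> (\<bar>err_pot n / s n\<bar> * A + K * \<bar>err_a n\<bar>) * K * s n"
    proof -
      have "cmod (of_real (err_pot n * (s n / a n)) + Ccoef n z * of_real (s n * err_a n))
          \<le> \<bar>err_pot n\<bar> * (s n / a n) + cmod (Ccoef n z) * (s n * \<bar>err_a n\<bar>)"
        by (rule order_trans[OF norm_triangle_ineq])
           (simp only: norm_mult norm_of_real abs_mult abs_of_nonneg[OF sa(1)] abs_of_pos[OF sp])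
      also have "\<dots> \<le> \<bar>err_pot n\<bar> * A + K * (s n * \<bar>err_a n\<bar>)"
        using sa cc sp by (intro add_mono mult_left_mono mult_right_mono) auto
      also have "\<dots> = (\<bar>err_pot n / s n\<bar> * A + K * \<bar>err_a n\<bar>) * s n"
        by (subst abs_s) (simp add: algebra_simps)
      finally have "cmod ?T5 \<le> (\<bar>err_pot n / s n\<bar> * A + K * \<bar>err_a n\<bar>) * s n * K"
        unfolding norm_mult using x r A sp by (intro mult_mono) auto
      then show ?thesis by (simp add: mult_ac)
    qed
    have tri: "cmod (t1 + t2 - t3 + t4 - t5) \<le> cmod t1 + cmod t2 + cmod t3 + cmod t4 + cmod t5" for t1 t2 t3 t4 t5
      using norm_triangle_ineq4[of "t1 + t2 - t3 + t4" t5] norm_triangle_ineq[of "t1 + t2 - t3" t4]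
        norm_triangle_ineq4[of "t1 + t2" t3] norm_triangle_ineq[of t1 t2] by linarith
    have "cmod (resid n z) \<le> cmod ?T1 + cmod ?T2 + cmod ?T3 + cmod ?T4 + cmod ?T5"
      unfolding resid_eq[OF n1] by (rule tri)
    also have "\<dots> \<le> (1 + A * K) * 2 * h n * s n + \<bar>err_scale n / s n\<bar> * K * s n + \<bar>err_pot n / s n\<bar> * s n
        + \<bar>err_quad n / s n\<bar> * K\<^sup>2 * s n + (\<bar>err_pot n / s n\<bar> * A + K * \<bar>err_a n\<bar>) * K * s n"
      by (intro add_mono 1 2 3 4 5)
    also have "\<dots> = g n * s n" by (simp add: g_def distrib_right)
    finally show ?thesis .
  qed
  have Yim: "Im (Y n z) = s n * Im (X n z)" for n z by (simp add: Y_def)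
  show ?thesis
  proof (rule that[of r N K "\<lambda>n. g n / c"])
    show "summable (\<lambda>n. g n / c)" by (intro summable_divide sumg)
    show "continuous_on ?U (Y n)" if n: "n \<ge> N" for n
    proof -
      have C: "continuous_on ?U (Ccoef n)" unfolding Ccoef_def[abs_def] by (intro continuous_intros)
      have B: "continuous_on ?U (Bcoef n)" unfolding Bcoef_def[abs_def] by (intro continuous_intros C)
      have D: "continuous_on ?U (Disc n)" unfolding Disc_def[abs_def] by (intro continuous_intros C B) auto
      have nonneg: "Disc n z \<notin> \<real>\<^sub>\<le>\<^sub>0" if "z \<in> ?U" for z
      proof
        assume "Disc n z \<in> \<real>\<^sub>\<le>\<^sub>0"
        then obtain x where "Disc n z = of_real x" "x \<le> 0" by (auto elim: nonpos_Reals_cases)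
        then have "Re (csqrt (Disc n z)) = 0" by simp
        then show False using bd[OF n that] r by simp
      qed
      have "continuous_on ?U (\<lambda>z. csqrt (Disc n z))"
        using nonneg by (intro continuous_on_compose2[OF continuous_on_csqrt D]) auto
      then show ?thesis unfolding Y_def[abs_def] X_def[abs_def] by (intro continuous_intros B) auto
    qed
    fix n z assume n: "n \<ge> N" and z: "z \<in> ?U"
    have n1: "n \<ge> 1" using n r by simp
    have sp: "s n > 0" by (rule s_pos[OF n1])
    have X1: "Im (X n z) \<ge> c" "cmod (X n z) \<le> K" and X2: "Im (X (Suc n) z) \<ge> c"
      using bd[OF n z] bd[of "Suc n" z] n z by auto
    have "Im (X n z) \<le> K" using X1 abs_Im_le_cmod[of "X n z"] by linarith
    then have b1: "Im (Y n z) \<le> K * s n" unfolding Yim using sp by (simp add: mult.commute)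
    have g0: "g n \<ge> 0" unfolding g_def using h(2)[OF n] A r by auto
    have "(s n * c) * (s n * c) \<le> (s n * Im (X n z)) * (s (Suc n) * Im (X (Suc n) z))"
      by (rule mult_mono[OF mult_mono mult_mono]) (use X1 X2 sp s_mono[of n] r in auto)
    then have "(c * s n) * (c * s n) \<le> Im (Y n z) * Im (Y (Suc n) z)"
      unfolding Yim by (simp only: mult.commute[of c])
    then have "sqrt ((c * s n) * (c * s n)) \<le> sqrt (Im (Y n z) * Im (Y (Suc n) z))"
      by (rule real_sqrt_le_mono)
    then have root: "c * s n \<le> sqrt (Im (Y n z) * Im (Y (Suc n) z))" using r sp by simp
    have "cmod (resid n z) \<le> g n / c * (c * s n)" using res[OF n z] r by simp
    also have "\<dots> \<le> g n / c * sqrt (Im (Y n z) * Im (Y (Suc n) z))"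
      using g0 r root by (intro mult_left_mono) auto
    finally have b2: "cmod (resid n z) \<le> g n / c * sqrt (Im (Y n z) * Im (Y (Suc n) z))" .
    have b0: "Im (Y n z) > 0" unfolding Yim using sp X1 r by (intro mult_pos_pos) auto
    show "Im (Y n z) > 0 \<and> Im (Y n z) \<le> K * s n
       \<and> cmod (resid n z) \<le> g n / c * sqrt (Im (Y n z) * Im (Y (Suc n) z)) \<and> 0 \<le> g n / c"
      using b0 b1 b2 g0 r by auto
  qed (use r in auto)
qed

end

section \<open>Boundary values of the Weyl function\<close>

context jacobi_critical
begin

text \<open>The value of the tail Weyl function at level \<open>n + 1\<close> that corresponds to the Riccati variable \<open>Y n z\<close>.\<close>

definition Z :: "nat \<Rightarrow> complex \<Rightarrow> complex" where
  "Z n z = (1 + Y n z / of_real (a n)) / of_real (a n)"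

lemma Im_Z: "Im (Z n z) = Im (Y n z) / (a n)\<^sup>2"
  by (simp add: Z_def Im_divide_of_real power2_eq_square)

lemma Z_eq: "Z n z = (of_real (a n) + Y n z) / of_real ((a n)\<^sup>2)"
  by (simp add: Z_def field_simps power2_eq_square)

lemma a_resid:
  "of_real (a n) * resid n z = (Y (Suc n) z - q n z) * (of_real (a n) + Y n z) - of_real (a n) * Y n z"
  by (simp add: resid_def field_simps)

lemma denom_Z:
  "of_real (b (Suc n)) - z - of_real ((a (Suc n))\<^sup>2) * Z (Suc n) z
     = of_real (a n) - (Y (Suc n) z - q n z)"
  using a_nz[of "Suc n"] unfolding Z_eq by (simp add: q_def)

text \<open>Passing from the Riccati variable to the Weyl function is a real Moebius map, so that the error of one
step, measured hyperbolically, is the same in both variables and in both directions of the recursion. The translation by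
\<open>Im z\<close> only enlarges the imaginary part in the denominator.\<close>

lemma hyp_close_of_resid:
  assumes Y: "Im (Y n z) > 0" "Im (Y (Suc n) z) > 0" and e: "0 \<le> e"
    and res: "cmod (resid n z) \<le> e * sqrt (Im (Y n z) * Im (Y (Suc n) z))"
  shows "Im z \<ge> 0 \<Longrightarrow> hyp_close e (Z n z) (weyl_map (Suc n) z (Z (Suc n) z))"
    and "Im z \<le> 0 \<Longrightarrow> hyp_close e (weyl_inv (Suc n) z (Z n z)) (Z (Suc n) z)"
proof -
  define y where "y = Y n z"
  define y' where "y' = Y (Suc n) z"
  define u where "u = y' - q n z"
  define A where "A = a n"
  define A' where "A' = a (Suc n)"
  define R where "R = resid n z"
  have A: "A > 0" "A' > 0" using a_pos by (auto simp: A_def A'_def)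
  have y: "Im y > 0" "Im y' > 0" using Y by (auto simp: y_def y'_def)
  have R: "of_real A * R = u * (of_real A + y) - of_real A * y"
    using a_resid[of n z] by (simp add: A_def R_def u_def y_def y'_def)
  have cR: "cmod R \<le> e * sqrt (Im y * Im y')" using res by (simp add: R_def y_def y'_def)
  have Imu: "Im u = Im y' + Im z" by (simp add: u_def q_def)
  have Zn: "Z n z = (of_real A + y) / of_real (A\<^sup>2)" "Im (Z n z) = Im y / A\<^sup>2"
    by (simp_all add: Z_eq Im_Z A_def y_def)
  have Zn': "Im (Z (Suc n) z) = Im y' / A'\<^sup>2" by (simp add: Im_Z A'_def y'_def)
  have pos: "Im (Z n z) > 0" "Im (Z (Suc n) z) > 0" using Zn(2) Zn' y A by auto
  {
    assume z: "Im z \<ge> 0"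
    define D where "D = of_real A - u"
    have T: "weyl_map (Suc n) z (Z (Suc n) z) = 1 / D"
      unfolding weyl_map_def denom_Z D_def A_def u_def y'_def ..
    have uy: "Im u \<ge> Im y'" "Im u > 0" using z Imu y by auto
    have D: "D \<noteq> 0" using uy(2) by (auto simp: D_def)
    have ImT: "Im (1 / D) = Im u / (cmod D)\<^sup>2" unfolding Im_inverse_complex by (simp add: D_def)
    have AC: "complex_of_real A \<noteq> 0" using A by simp
    have "Z n z - 1 / D = ((of_real A + y) * D - of_real A * of_real A) / (of_real A * of_real A * D)"
      unfolding Zn using AC D by (simp add: field_simps power2_eq_square)
    also have "(of_real A + y) * D - of_real A * of_real A = - (of_real A * R)"
      unfolding R D_def by (simp add: algebra_simps)
    also have "- (of_real A * R) / (of_real A * of_real A * D) = - R / (of_real A * D)" using AC by simp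
    finally have "cmod (Z n z - 1 / D) = cmod R / (A * cmod D)"
      using A by (simp add: norm_divide norm_mult)
    also have "\<dots> \<le> e * sqrt (Im y * Im y') / (A * cmod D)"
      using cR A by (intro divide_right_mono) auto
    also have "\<dots> \<le> e * sqrt (Im y * Im u) / (A * cmod D)"
      using uy y e A by (intro divide_right_mono mult_left_mono real_sqrt_le_mono) auto
    also have "\<dots> = e * sqrt (Im (Z n z) * Im (1 / D))"
      unfolding Zn(2) ImT using A by (simp add: real_sqrt_mult real_sqrt_divide)
    finally show "hyp_close e (Z n z) (weyl_map (Suc n) z (Z (Suc n) z))"
      unfolding T hyp_close_def using e pos uy(2) D by (simp add: ImT)
  }
  {
    assume z: "Im z \<le> 0"
    define w where "w = of_real A + y"
    have Imw: "Im w = Im y" by (simp add: w_def)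
    have w: "w \<noteq> 0" using Imw y by auto
    have AC: "complex_of_real A \<noteq> 0" "complex_of_real A' \<noteq> 0" using A by auto
    define V where "V = weyl_inv (Suc n) z (Z n z)"
    have inv: "1 / Z n z = of_real (A\<^sup>2) / w" unfolding Zn w_def by simp
    have V: "V = (of_real (b (Suc n)) - z - of_real (A\<^sup>2) / w) / of_real (A'\<^sup>2)"
      unfolding V_def weyl_inv_def inv A'_def ..
    have ImV: "Im V = (- Im z + A\<^sup>2 * Im y / (cmod w)\<^sup>2) / A'\<^sup>2"
    proof -
      have "Im (of_real (A\<^sup>2) / w) = - (A\<^sup>2 * Im y / (cmod w)\<^sup>2)"
        using Im_inverse_complex[of w] Imw by (simp add: Im_divide cmod_power2 field_simps del: of_real_power)
      then show ?thesis unfolding V Im_divide_of_real minus_complex.sel by simp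
    qed
    have ImV_ge: "Im V \<ge> (A\<^sup>2 * Im y / (cmod w)\<^sup>2) / A'\<^sup>2"
      unfolding ImV using z A by (intro divide_right_mono) auto
    have ImV_pos: "(A\<^sup>2 * Im y / (cmod w)\<^sup>2) / A'\<^sup>2 > 0" using A y w by simp
    have Z': "Z (Suc n) z = (of_real A' + y') / of_real (A'\<^sup>2)"
      by (simp add: Z_eq A'_def y'_def)
    have "V - Z (Suc n) z = (of_real A - of_real (A\<^sup>2) / w - u) / of_real (A'\<^sup>2)"
      unfolding V Z' diff_divide_distrib[symmetric] by (simp add: u_def q_def A_def A'_def algebra_simps)
    also have "of_real A - of_real (A\<^sup>2) / w - u = - (of_real A * R) / w"
      unfolding R using w by (simp add: field_simps w_def power2_eq_square)
    finally have "cmod (V - Z (Suc n) z) = A * cmod R / cmod w / A'\<^sup>2"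
      using A by (simp add: norm_divide norm_mult norm_power)
    also have "\<dots> \<le> A * (e * sqrt (Im y * Im y')) / cmod w / A'\<^sup>2"
      using cR A by (intro divide_right_mono mult_left_mono) auto
    also have "\<dots> = e * sqrt ((A\<^sup>2 * Im y / (cmod w)\<^sup>2) / A'\<^sup>2 * Im (Z (Suc n) z))"
    proof -
      have "(A\<^sup>2 * Im y / (cmod w)\<^sup>2) / A'\<^sup>2 * Im (Z (Suc n) z) = (A / (cmod w * A'\<^sup>2))\<^sup>2 * (Im y * Im y')"
        unfolding Zn' by (simp add: power_divide power_mult_distrib power2_eq_square mult_ac)
      then have "sqrt ((A\<^sup>2 * Im y / (cmod w)\<^sup>2) / A'\<^sup>2 * Im (Z (Suc n) z)) = A / (cmod w * A'\<^sup>2) * sqrt (Im y * Im y')"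
        using A by (simp add: real_sqrt_mult)
      then show ?thesis by (simp add: mult_ac)
    qed
    also have "\<dots> \<le> e * sqrt (Im V * Im (Z (Suc n) z))"
      using e pos ImV_ge by (intro mult_left_mono real_sqrt_le_mono mult_right_mono) auto
    finally show "hyp_close e (weyl_inv (Suc n) z (Z n z)) (Z (Suc n) z)"
      unfolding V_def[symmetric] hyp_close_def using e pos ImV_pos ImV_ge by auto
  }
qed

lemma not_summable_s: "K > 0 \<Longrightarrow> \<not> summable (\<lambda>n. 1 / (K * s n))"
proof
  assume K: "K > 0" and "summable (\<lambda>n. 1 / (K * s n))"
  then have "summable (\<lambda>n. K * (1 / (K * s n)))" by (intro summable_mult)
  then have "summable (\<lambda>n. real n powr (- \<rho>))"
    using K by (simp add: s_def powr_minus inverse_eq_divide)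
  then show False using exponents by (simp add: summable_real_powr_iff)
qed

lemma Llim_nonreal: "Im z \<noteq> 0 \<Longrightarrow> Llim z \<notin> \<real>\<^sub>\<le>\<^sub>0"
  using \<tau>_neg by (auto simp: Llim_def complex_nonpos_Reals_iff)

text \<open>The lower half-plane suffices, since \<open>P\<close> commutes with complex conjugation.\<close>

lemma P_not_l2_lower:
  assumes z: "Im z < 0"
  shows "P z \<notin> l2"
proof -
  obtain r N K e where r: "r > 0" "N \<ge> 1" "K > 0" "summable e" and
    bd: "\<And>n z'. n \<ge> N \<Longrightarrow> z' \<in> cball z r \<Longrightarrow> Im (Y n z') > 0 \<and> Im (Y n z') \<le> K * s n
       \<and> cmod (resid n z') \<le> e n * sqrt (Im (Y n z') * Im (Y (Suc n) z')) \<and> 0 \<le> e n"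
    using local_residual[OF Llim_nonreal] z by (metis less_irrefl)
  have zz: "z \<in> cball z r" using r by simp
  show ?thesis
  proof (rule P_not_l2[OF z r(4), where N=N and Z="\<lambda>n. Z n z" and s="\<lambda>n. K * s n"])
    fix n assume n: "n \<ge> N"
    show "hyp_close (e n) (weyl_inv (Suc n) z (Z n z)) (Z (Suc n) z)"
      using bd[OF n zz] bd[of "Suc n", OF _ zz] n z by (intro hyp_close_of_resid(2)) auto
    show "Im (Z n z) \<le> K * s n / (a n)\<^sup>2" unfolding Im_Z
      using bd[OF n zz] by (intro divide_right_mono) auto
    show "K * s n > 0" using r n s_pos[of n] by simp
  next
    show "\<not> summable (\<lambda>n. 1 / (K * s n))" by (rule not_summable_s[OF r(3)])
    show "Im (Z N z) > 0" unfolding Im_Z using bd[OF order_refl zz] a_pos[of N] by simp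
  qed
qed

definition M :: "complex \<Rightarrow> complex" where
  "M z = lim (\<lambda>n. weyl_comp (Suc n) z (Z n z))"

text \<open>The points \<open>Z n z\<close> and the errors are controlled only near each point, so \<open>weyl_limit_continuous\<close> is
applied on the parts of small discs in the closed upper half-plane; the pointwise limit defining \<open>M\<close> does not depend on them.\<close>

lemma M_local:
  assumes L: "Llim z0 \<notin> \<real>\<^sub>\<le>\<^sub>0"
  obtains r N where "r > 0" "continuous_on (cball z0 r \<inter> {z. Im z \<ge> 0}) M"
    "\<And>z. z \<in> cball z0 r \<Longrightarrow> Im z \<ge> 0 \<Longrightarrow> (\<lambda>n. weyl_comp (Suc n) z (Z n z)) \<longlonglongrightarrow> M z"
    "\<And>n z. n \<ge> N \<Longrightarrow> z \<in> cball z0 r \<Longrightarrow> Im (Z n z) > 0"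
proof -
  obtain r N K e where r: "r > 0" "N \<ge> 1" "K > 0" "summable e" and
    bd: "\<And>n z. n \<ge> N \<Longrightarrow> z \<in> cball z0 r \<Longrightarrow> Im (Y n z) > 0 \<and> Im (Y n z) \<le> K * s n
       \<and> cmod (resid n z) \<le> e n * sqrt (Im (Y n z) * Im (Y (Suc n) z)) \<and> 0 \<le> e n" and
    cont: "\<And>n. n \<ge> N \<Longrightarrow> continuous_on (cball z0 r) (Y n)"
    using local_residual[OF L] by metis
  let ?U = "cball z0 r \<inter> {z. Im z \<ge> 0}"
  have "\<exists>M'. continuous_on ?U M' \<and> (\<forall>z\<in>?U. (\<lambda>n. weyl_comp (Suc n) z (Z n z)) \<longlonglongrightarrow> M' z)"
  proof (rule weyl_limit_continuous[OF _ _ r(4)])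
    show "compact ?U"
      by (intro compact_Int_closed compact_cball closed_halfspace_Im_ge)
    show "Im z \<ge> 0" if "z \<in> ?U" for z using that by simp
    fix n assume n: "n \<ge> N"
    show "hyp_close (e n) (Z n z) (weyl_map (Suc n) z (Z (Suc n) z))" if z: "z \<in> ?U" for z
      using bd[OF n, of z] bd[of "Suc n" z] n z by (intro hyp_close_of_resid(1)) auto
    have "continuous_on ?U (Y n)" using cont[OF n] by (rule continuous_on_subset) auto
    then show "continuous_on ?U (Z n)" unfolding Z_def[abs_def] by (intro continuous_intros) auto
  qed
  then obtain M' where M': "continuous_on ?U M'"
    "\<And>z. z \<in> ?U \<Longrightarrow> (\<lambda>n. weyl_comp (Suc n) z (Z n z)) \<longlonglongrightarrow> M' z" by blast
  have eq: "M z = M' z" if "z \<in> ?U" for z unfolding M_def using limI[OF M'(2)[OF that]] .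
  show ?thesis
  proof (rule that[OF r(1)])
    show "continuous_on ?U M" by (rule iffD2[OF continuous_on_cong[OF refl eq] M'(1)])
    show "(\<lambda>n. weyl_comp (Suc n) z (Z n z)) \<longlonglongrightarrow> M z" if "z \<in> cball z0 r" "Im z \<ge> 0" for z
      using M'(2)[of z] eq[of z] that by simp
    show "Im (Z n z) > 0" if "n \<ge> N" "z \<in> cball z0 r" for n z
      unfolding Im_Z using bd[OF that] a_pos[of n] by simp
  qed
qed

lemma continuous_on_M: "continuous_on {z. Im z \<ge> 0 \<and> Llim z \<notin> \<real>\<^sub>\<le>\<^sub>0} M" (is "continuous_on ?S M")
  unfolding continuous_on_eq_continuous_within
proof
  fix z0 assume z0: "z0 \<in> ?S"
  then have nz: "Llim z0 \<notin> \<real>\<^sub>\<le>\<^sub>0" by simp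
  obtain r where r: "r > 0" "continuous_on (cball z0 r \<inter> {z. Im z \<ge> 0}) M"
    by (rule M_local[OF nz]) blast
  have "continuous (at z0 within cball z0 r \<inter> {z. Im z \<ge> 0}) M"
    using r z0 by (simp add: continuous_on_eq_continuous_within)
  then have "continuous (at z0 within ?S \<inter> ball z0 r) M"
    by (rule continuous_within_subset) auto
  moreover have "at z0 within ?S = at z0 within ?S \<inter> ball z0 r"
    by (rule at_within_nhd[of z0 "ball z0 r"]) (use r in auto)
  ultimately show "continuous (at z0 within ?S) M" by (simp add: continuous_within)
qed

lemma weyl_M:
  assumes z: "Im z > 0"
  shows "weyl z (M z)"
proof -
  have nz: "Llim z \<notin> \<real>\<^sub>\<le>\<^sub>0" using z by (intro Llim_nonreal) simp
  obtain N where r: "(\<lambda>n. weyl_comp (Suc n) z (Z n z)) \<longlonglongrightarrow> M z" "\<And>n. n \<ge> N \<Longrightarrow> Im (Z n z) > 0"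
  proof (rule M_local[OF nz])
    fix r :: real and N
    assume "r > 0"
      and lim: "\<And>z'. z' \<in> cball z r \<Longrightarrow> Im z' \<ge> 0 \<Longrightarrow> (\<lambda>n. weyl_comp (Suc n) z' (Z n z')) \<longlonglongrightarrow> M z'"
      and pos: "\<And>n z'. n \<ge> N \<Longrightarrow> z' \<in> cball z r \<Longrightarrow> Im (Z n z') > 0"
    then have "z \<in> cball z r" by simp
    then show thesis using that[of N] lim[of z] pos z by simp
  qed
  have "sol a b z delta0 (M z) \<in> l2" by (rule weyl_limit_l2[OF z r(2) r(1)])
  moreover have "P z \<notin> l2"
    using P_not_l2_lower[of "cnj z"] z using sol_cnj[where h="\<lambda>_. 0" and c=1] by (simp add: l2_def)
  ultimately show ?thesis using z by (simp add: weyl_def)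
qed

lemma cut_in_domain:
  assumes "x \<in> cut_set 1 \<sigma> \<tau>"
  shows "Llim (of_real x) \<notin> \<real>\<^sub>\<le>\<^sub>0"
  using assms \<tau>_neg by (auto simp: Llim_def cut_set_def complex_nonpos_Reals_iff split: if_splits)

lemma continuous_on_M_cut: "continuous_on ({z. Im z > 0} \<union> complex_of_real ` cut_set 1 \<sigma> \<tau>) M"
  by (rule continuous_on_subset[OF continuous_on_M])
     (use Llim_nonreal cut_in_domain in \<open>auto dest: less_imp_neq\<close>)

end

section \<open>Symmetries and conclusion\<close>

lemma (in jacobi) weyl_cnj: "weyl z M \<Longrightarrow> weyl (cnj z) (cnj M)"
  using sol_cnj[where h="\<lambda>_. 0" and c=1] sol_cnj[where h=delta0]
  by (simp add: weyl_def l2_def)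

text \<open>Conjugating \<open>J\<close> by the alternating signs \<open>(-1)\<^sup>n\<close> turns \<open>J\<close> into minus the operator with coefficients
\<open>a\<close> and \<open>- b\<close>.\<close>

lemma weyl_neg:
  assumes J: "jacobi a" and w: "jacobi.weyl a b z M"
  shows "jacobi.weyl a (\<lambda>n. - b n) (- z) (- M)"
proof -
  have P: "sol a (\<lambda>n. - b n) (- z) (\<lambda>_. 0) 1 n = (-1)^n * sol a b z (\<lambda>_. 0) 1 n \<and>
      sol a (\<lambda>n. - b n) (- z) (\<lambda>_. 0) 1 (Suc n) = (-1)^Suc n * sol a b z (\<lambda>_. 0) 1 (Suc n)" for n
    by (induction n) (simp_all add: field_simps)
  have f: "sol a (\<lambda>n. - b n) (- z) delta0 (- M) n = (-1)^Suc n * sol a b z delta0 M n \<and>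
      sol a (\<lambda>n. - b n) (- z) delta0 (- M) (Suc n) = (-1)^Suc (Suc n) * sol a b z delta0 M (Suc n)" for n
    using J by (induction n) (simp_all add: field_simps jacobi_def)
  show ?thesis using w unfolding jacobi.weyl_def[OF J]
    by (simp add: l2_def P f norm_mult norm_power del: power_Suc)
qed

lemma continuous_up_to_cut_weyl:
  assumes J: "jacobi a"
    and up: "continuous_on ({z. Im z > 0} \<union> complex_of_real ` S) Mp" "\<And>z. Im z > 0 \<Longrightarrow> jacobi.weyl a b z (Mp z)"
    and low: "continuous_on ({z. Im z < 0} \<union> complex_of_real ` S) Mm" "\<And>z. Im z < 0 \<Longrightarrow> jacobi.weyl a b z (Mm z)"
    and u: "finitely_supported u" and v: "finitely_supported v"
  shows "continuous_up_to_cut (\<lambda>z. l2_inner (resolvent (jacobi_op a b) z u) v) S"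
proof -
  define G where "G M z = (\<Sum>n | v n \<noteq> 0. (\<Sum>k | u k \<noteq> 0. u k * jacobi.Green a b z (M z) k n) * cnj (v n))"
    for M :: "complex \<Rightarrow> complex" and z
  have cont: "continuous_on A (G M)" if "continuous_on A M" for A M
    unfolding G_def[abs_def]
    by (intro continuous_intros jacobi.continuous_on_Green[OF J that])
  have eq: "G M z = l2_inner (resolvent (jacobi_op a b) z u) v" if "jacobi.weyl a b z (M z)" for M z
    unfolding G_def jacobi.inner_resolvent[OF J that u v] ..
  show ?thesis
    unfolding continuous_up_to_cut_def
    using cont[OF up(1)] cont[OF low(1)] eq up(2) low(2) by blast
qed

theorem theorem7p4:
  fixes \<gamma> \<sigma> \<alpha> \<beta> \<tau> :: real and a b :: "nat \<Rightarrow> real"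
  assumes "\<gamma> \<in> {1, -1}"
    and "0 < \<sigma>" and "\<sigma> \<le> 3 / 2"
    and "\<And>n. a n > 0"
    and "(\<lambda>n. a n / real n powr \<sigma> - (1 + \<alpha> / real n)) \<in> O(\<lambda>n. 1 / (real n)\<^sup>2)"
    and "(\<lambda>n. b n / (2 * \<gamma> * real n powr \<sigma>) - (1 + \<beta> / real n)) \<in> O(\<lambda>n. 1 / (real n)\<^sup>2)"
    and "\<tau> = 2 * \<beta> - 2 * \<alpha> + \<sigma>"
    and "\<sigma> > 1 \<Longrightarrow> \<tau> < 0"
  shows "\<forall>u v. finitely_supported u \<longrightarrow> finitely_supported v \<longrightarrow>
           continuous_up_to_cut (\<lambda>z. l2_inner (resolvent (jacobi_op a b) z u) v) (cut_set \<gamma> \<sigma> \<tau>)"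
proof (intro allI impI)
  fix u v assume uv: "finitely_supported u" "finitely_supported v"
  \<comment> \<open>the analysis is carried out for \<open>\<gamma> = 1\<close>, with the reflected diagonal if \<open>\<gamma> = -1\<close>\<close>
  define b' where "b' n = \<gamma> * b n" for n
  have g: "\<gamma> = 1 \<or> \<gamma> = -1" using assms(1) by auto
  have b': "(\<lambda>n. b' n / (2 * real n powr \<sigma>) - (1 + \<beta> / real n)) \<in> O(\<lambda>n. 1 / (real n)\<^sup>2)"
    using assms(6) g by (auto simp: b'_def)
  interpret J: jacobi_critical a b' \<sigma> \<alpha> \<beta> \<tau>
    using assms b' by unfold_locales auto
  let ?S = "cut_set 1 \<sigma> \<tau>"
  define M' where "M' z = cnj (J.M (cnj z))" for z
  have Jloc: "jacobi a" by unfold_locales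
  have up: "continuous_on ({z. Im z > 0} \<union> complex_of_real ` ?S) J.M" "\<And>z. Im z > 0 \<Longrightarrow> J.weyl z (J.M z)"
    by (rule J.continuous_on_M_cut, rule J.weyl_M)
  have low: "continuous_on ({z. Im z < 0} \<union> complex_of_real ` ?S) M'" "\<And>z. Im z < 0 \<Longrightarrow> J.weyl z (M' z)"
  proof -
    show "continuous_on ({z. Im z < 0} \<union> complex_of_real ` ?S) M'"
      unfolding M'_def[abs_def]
      by (intro continuous_intros continuous_on_compose2[OF up(1)]) auto
    show "J.weyl z (M' z)" if "Im z < 0" for z
      using J.weyl_cnj[OF up(2)[of "cnj z"]] that by (simp add: M'_def)
  qed
  show "continuous_up_to_cut (\<lambda>z. l2_inner (resolvent (jacobi_op a b) z u) v) (cut_set \<gamma> \<sigma> \<tau>)"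
    using g
  proof
    assume "\<gamma> = 1"
    then show ?thesis
      using continuous_up_to_cut_weyl[OF Jloc up low uv] by (simp add: b'_def[abs_def])
  next
    assume gm: "\<gamma> = -1"
    have bb: "(\<lambda>n. - b' n) = b" by (simp add: b'_def gm)
    have S: "cut_set (-1) \<sigma> \<tau> = uminus ` ?S"
      by (auto simp: cut_set_def image_image)
    have neg: "jacobi.weyl a b z (- M (- z))" if "J.weyl (- z) (M (- z))" for M z
      using weyl_neg[OF Jloc that] unfolding bb by simp
    have "continuous_on ({z. Im z > 0} \<union> complex_of_real ` cut_set (-1) \<sigma> \<tau>) (\<lambda>z. - M' (- z))"
      unfolding S by (intro continuous_intros continuous_on_compose2[OF low(1)]) auto
    moreover have "continuous_on ({z. Im z < 0} \<union> complex_of_real ` cut_set (-1) \<sigma> \<tau>) (\<lambda>z. - J.M (- z))"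
      unfolding S by (intro continuous_intros continuous_on_compose2[OF up(1)]) auto
    ultimately show ?thesis unfolding gm
      using up(2) low(2) uv by (intro continuous_up_to_cut_weyl[OF Jloc _ neg _ neg]) auto
  qed
qed

end
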